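(* Let $l\ge1$ be an integer and let $0<p_0<p_1<\cdots<p_l<1$. For each integer $N\ge l$ let $M_i=M_i(N)$, $i=1,\dots,l$, be integers with $1\le M_1<\cdots<M_l\le N$, and suppose that $\lim_{N\to\infty}\frac{M_i}{N}=r_i$ for $i=1,\dots,l$ (the $r_i\in[0,1]$ are not required to be distinct). Set $M_0=0$, $M_{l+1}=N+1$, $r_0=0$ and $r_{l+1}=1$. Let $s(N,M_1,\dots,M_l;p_0,\dots,p_l)$ be the speed of the random walk excited by its recent history with history window $N$, thresholds $M_1,\dots,M_l$ and probabilities $p_0,\dots,p_l$. For $i\in\{0,\dots,l\}$ put $$ K_i:=\frac1{p_i^{r_i}(1-p_i)^{1-r_i}}\prod_{k=1}^i\left(\frac{p_{k-1}}{1-p_{k-1}}\right)^{r_k-r_{k-1}}. $$ (i) If $$ \operatorname{argmax}_{i\in\{0,\dots,l\}:\ r_i<p_i<r_{i+1}}K_i=\{i_0\}, $$ then $$ \lim_{N\to\infty}s(N,M_1,\dots,M_l;p_0,\dots,p_l)=2p_{i_0}-1. $$ (ii) If $$ \operatorname{argmax}_{i\in\{0,\dots,l\}:\ r_i<p_i<r_{i+1}}K_i=\{i_1,\dots,i_d\} $$ with $d\ge2$ (the $i_j$ distinct), and $$ \alpha_{i_j}:=\lim_{N\to\infty}\left(\frac{p_{i_j}}{1-p_{i_j}}\right)^{-M_{i_j}+Nr_{i_j}}\prod_{k=1}^{i_j}\left(\frac{p_{k-1}}{1-p_{k-1}}\right)^{(M_k-Nr_k)-(M_{k-1}-Nr_{k-1})}\in[0,\infty]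 $$ (the limit existing) for $j=1,\dots,d$, with at most one $j$ for which $\alpha_{i_j}=\infty$, then $$ \lim_{N\to\infty}s(N,M_1,\dots,M_l;p_0,\dots,p_l)=\frac{\sum_{j=1}^d\frac{\alpha_{i_j}}{1-p_{i_j}}(2p_{i_j}-1)}{\sum_{j=1}^d\frac{\alpha_{i_j}}{1-p_{i_j}}}, $$ where, if $\alpha_{i_{j}}=\infty$ for one index $j$, the right hand side is interpreted as $2p_{i_{j}}-1$ for that $j$.
   Context: The process (random walk excited by its recent history, $l$ threshold stages): with $M_0=0$ and $M_{l+1}=N+1$, $\{X_n\}_{n=0}^\infty$ takes values in $\mathbb{Z}$, starts from a fixed integer $X_0$, and at each step jumps by $+1$ (right) or $-1$ (left). Each of the first $N$ jumps is, independently, to the right with probability $p_0$ and to the left with probability $1-p_0$. At every subsequent step, conditionally on the whole past: for $i=0,1,\dots,l$, if the number of jumps to the right among the $N$ most recent jumps is between $M_i$ and $M_{i+1}-1$ (inclusive), then the next jump is to the right with probability $p_i$ and to the left with probability $1-p_i$. The speed $s(N,M_1,\dots,M_l;p_0,\dots,p_l)$ is the deterministic constant $\lim_{n\to\infty}X_n/n$ (almost sure limit; it exists). A void product $\prod_{k=1}^0$ equals $1$. Notation: $\operatorname{argmax}_{i\in A}f(i)=\{j\in A: f(j)=\max_{i\in A}f(i)\}$.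
   Formalization: In part (ii) it is additionally assumed that the limits α_{i_j} are not all 0, since otherwise the quotient on the right-hand side is 0/0 and undefined. *)

theory Defs
  imports "HOL-Probability.Probability"
begin

definition right_jumps :: "nat \<Rightarrow> (nat \<Rightarrow> int) \<Rightarrow> nat \<Rightarrow> nat" where
  "right_jumps N x n = card {k \<in> {n - N..<n}. x (Suc k) = x k + 1}"

text \<open>
  The jump with index \<open>n\<close> leads from \<open>X n\<close> to \<open>X (Suc n)\<close>, so the first \<open>N\<close> jumps are those
  with \<open>n < N\<close>. The thresholds are \<open>T 0, \<dots>, T (Suc l)\<close>, where the convention
  \<open>T 0 = 0\<close> and \<open>T (Suc l) = Suc N\<close> is left to the user of the locale. Conditioning on the
  whole past is elementary, since the past takes only countably many values. The
  probability of a jump to the left is determined by \<open>jump\<close>.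
\<close>

locale excited_walk = prob_space P
  for P :: "'a measure" +
  fixes X :: "nat \<Rightarrow> 'a \<Rightarrow> int"
    and x0 :: int
    and N l :: nat
    and T :: "nat \<Rightarrow> nat"
    and p :: "nat \<Rightarrow> real"
  assumes measurable_X: "\<And>n. X n \<in> measurable P (count_space UNIV)"
    and start: "AE \<omega> in P. X 0 \<omega> = x0"
    and jump: "AE \<omega> in P. \<forall>n. X (Suc n) \<omega> - X n \<omega> \<in> {1, -1}"
    and initial_indep:
      "indep_vars (\<lambda>_. count_space UNIV) (\<lambda>n \<omega>. X (Suc n) \<omega> - X n \<omega>) {..<N}"
    and initial_prob:
      "\<And>n. n < N \<Longrightarrow> \<P>(\<omega> in P. X (Suc n) \<omega> = X n \<omega> + 1) = p 0"
    and excited_prob: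
      "\<And>n x i. n \<ge> N \<Longrightarrow> \<P>(\<omega> in P. \<forall>k\<le>n. X k \<omega> = x k) > 0 \<Longrightarrow> i \<le> l \<Longrightarrow>
         T i \<le> right_jumps N x n \<Longrightarrow> right_jumps N x n < T (Suc i) \<Longrightarrow>
         \<P>(\<omega> in P. X (Suc n) \<omega> = X n \<omega> + 1 \<bar> \<forall>k\<le>n. X k \<omega> = x k) = p i"

definition speed :: "'a measure \<Rightarrow> (nat \<Rightarrow> 'a \<Rightarrow> int) \<Rightarrow> real" where
  "speed P X = (THE v. AE \<omega> in P. (\<lambda>n. real_of_int (X n \<omega>) / real n) \<longlonglongrightarrow> v)"

definition argmax :: "('b \<Rightarrow> real) \<Rightarrow> 'b set \<Rightarrow> 'b set" where
  "argmax f A = {j \<in> A. f j = Max (f ` A)}"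

definition K :: "(nat \<Rightarrow> real) \<Rightarrow> (nat \<Rightarrow> real) \<Rightarrow> nat \<Rightarrow> real" where
  "K p r i = 1 / (p i powr r i * (1 - p i) powr (1 - r i)) *
     (\<Prod>k=1..i. (p (k - 1) / (1 - p (k - 1))) powr (r k - r (k - 1)))"

definition dominant :: "nat \<Rightarrow> (nat \<Rightarrow> real) \<Rightarrow> (nat \<Rightarrow> real) \<Rightarrow> nat set" where
  "dominant l p r = argmax (K p r) {i \<in> {0..l}. r i < p i \<and> p i < r (Suc i)}"

definition alpha_seq ::
  "(nat \<Rightarrow> real) \<Rightarrow> (nat \<Rightarrow> real) \<Rightarrow> (nat \<Rightarrow> nat \<Rightarrow> nat) \<Rightarrow> nat \<Rightarrow> nat \<Rightarrow> real" where
  "alpha_seq p r M i N =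
     (p i / (1 - p i)) powr (- real (M N i) + real N * r i) *
     (\<Prod>k=1..i. (p (k - 1) / (1 - p (k - 1))) powr
        ((real (M N k) - real N * r k) - (real (M N (k - 1)) - real N * r (k - 1))))"

end

theory Submission
  imports Defs
begin

text \<open>
  For fixed \<open>N\<close> the last \<open>N\<close> jumps form a Markov chain on bit strings of length \<open>N\<close>. Its stationary
  weight is exchangeable, that is, a function of the number \<open>s\<close> of right jumps only, and the balance
  equation \<open>f (s + 1) * (1 - q (s + 1)) = f s * q s\<close> determines it. The chain mixes because every string
  is reached in \<open>N\<close> steps with probability bounded below, so a strong law for orthogonal increments
  gives the speed as a stationary average.

  The total stationary weight of stage \<open>i\<close> is proportional to
  \<open>K i ^ N * alpha_seq i N * P(M N i \<le> Bin(N, p i) < M N (i + 1)) / (1 - p i)\<close>. If \<open>r i < p i < r (i + 1)\<close>,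
  the binomial probability tends to 1. Otherwise some other stage satisfying this condition has a
  strictly larger \<open>K\<close>. Since \<open>alpha_seq i\<close> is subexponential, only the dominant stages survive in
  the limit.
\<close>

section \<open>A strong law for orthogonal increments\<close>

text \<open>The hypotheses speak only of conditional probabilities of paths, so time averages are
  reached through martingale differences. For a function \<open>\<phi>\<close> of the window,
  \<open>\<phi>\<close> at the next window minus its conditional mean
  \<open>transfer q \<phi>\<close> at the current one is bounded and orthogonal to the past, so its
  average vanishes. After telescoping, \<open>\<phi>\<close> and \<open>transfer q \<phi>\<close>
  have the same time average; the same then holds for all iterates, and mixing makes a high iterate
  almost constant.

  In the limit of large \<open>N\<close> the obstacle is that the convergence of
  \<open>M N i / N\<close> to \<open>r i\<close> comes without a rate: \<open>alpha_seq\<close> may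
  tend to 0, diverge or oscillate. Its \<open>N\<close>-th root still tends to 1, so a strict
  inequality between values of \<open>K\<close> settles every comparison with a stage outside the
  dominant set. Inside that set the weights are divided either by the common \<open>K ^ N\<close>,
  when the limits are finite, or by the full scale of one stage, when that stage wins alone.

  That an inadmissible stage is beaten follows by moving along neighbouring stages: \<open>K\<close>
  increases strictly at the first move and never decreases until an admissible stage is met.\<close>

lemma (in prob_space) strong_law_orthogonal_sums:
  fixes d :: "nat \<Rightarrow> 'a \<Rightarrow> real"
  assumes meas [measurable]: "\<And>n. d n \<in> borel_measurable M"
    and bound: "\<And>n \<omega>. \<bar>d n \<omega>\<bar> \<le> C"
    and orth: "\<And>n. expectation (\<lambda>\<omega>. (\<Sum>k<n. d k \<omega>) * d n \<omega>) = 0"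
  shows "AE \<omega> in M. (\<lambda>n. (\<Sum>k<n. d k \<omega>) / real n) \<longlonglongrightarrow> 0"
proof -
  define S where "S n \<omega> = (\<Sum>k<n. d k \<omega>)" for n \<omega>
  have S_meas [measurable]: "S n \<in> borel_measurable M" for n
    unfolding S_def by measurable
  have C0: "0 \<le> C" using bound[of 0] by (meson abs_ge_zero order_trans)
  have S_diff: "\<bar>S n \<omega> - S m \<omega>\<bar> \<le> C * (real n - real m)" if "m \<le> n" for m n \<omega>
    using that
  proof (induction n rule: dec_induct)
    case (step n)
    show ?case
      using step.IH bound[of n \<omega>] by (simp add: S_def algebra_simps)
  qed simp
  have S_bound: "\<bar>S n \<omega>\<bar> \<le> C * real n" for n \<omega>
    using S_diff[of 0 n \<omega>] by (simp add: S_def)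
  have int_bdd: "integrable M h" if "h \<in> borel_measurable M" "\<And>\<omega>. \<bar>h \<omega>\<bar> \<le> c"
    for h :: "'a \<Rightarrow> real" and c
    using that by (intro integrable_const_bound[where B = c]) auto
  have square_mono: "y\<^sup>2 \<le> z\<^sup>2" if "\<bar>y\<bar> \<le> z" for y z :: real
    using power_mono[OF that, of 2] by simp
  have int_sq: "integrable M (\<lambda>\<omega>. (S n \<omega>)\<^sup>2)" for n
    by (rule int_bdd[of _ "(C * real n)\<^sup>2"]) (use square_mono[OF S_bound] in auto)
  have int_d: "integrable M (\<lambda>\<omega>. (d n \<omega>)\<^sup>2)" for n
    by (rule int_bdd[of _ "C\<^sup>2"]) (use square_mono[OF bound] in auto)
  have int_Sd: "integrable M (\<lambda>\<omega>. S n \<omega> * d n \<omega>)" for n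
    by (rule int_bdd[of _ "(C * real n) * C"])
       (auto simp: abs_mult C0 intro!: mult_mono S_bound bound)
  \<comment> \<open>Expanding the square leaves one cross term, the product of the partial sum and
    the next increment; its mean is 0 by \<open>orth\<close>. The second moment therefore grows only
    linearly.\<close>
  have second_moment: "expectation (\<lambda>\<omega>. (S n \<omega>)\<^sup>2) \<le> C\<^sup>2 * real n" for n
  proof (induction n)
    case (Suc n)
    have "(S (Suc n) \<omega>)\<^sup>2 = (S n \<omega>)\<^sup>2 + 2 * (S n \<omega> * d n \<omega>) + (d n \<omega>)\<^sup>2" for \<omega>
      by (simp add: S_def power2_sum)
    then have "expectation (\<lambda>\<omega>. (S (Suc n) \<omega>)\<^sup>2)
        = expectation (\<lambda>\<omega>. (S n \<omega>)\<^sup>2) + 2 * expectation (\<lambda>\<omega>. S n \<omega> * d n \<omega>)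
          + expectation (\<lambda>\<omega>. (d n \<omega>)\<^sup>2)"
      using int_sq int_d int_Sd by simp
    also have "expectation (\<lambda>\<omega>. S n \<omega> * d n \<omega>) = 0"
      using orth unfolding S_def .
    also have "expectation (\<lambda>\<omega>. (d n \<omega>)\<^sup>2) \<le> C\<^sup>2"
      using int_d square_mono[OF bound] by (intro integral_le_const) auto
    finally show ?case using Suc by (simp add: algebra_simps)
  qed (simp add: S_def)
  \<comment> \<open>Chebyshev bounds of order \<open>1 / n\<close> are not summable over all
    \<open>n\<close>, but along the squares they are. \<open>Suc m\<close> keeps the denominator
    away from 0.\<close>
  define Y where "Y m \<omega> = (S ((Suc m)\<^sup>2) \<omega> / real ((Suc m)\<^sup>2))\<^sup>2" for m \<omega>
  have Y_meas [measurable]: "Y m \<in> borel_measurable M" for m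
    unfolding Y_def by measurable
  have Y_int: "(\<integral>\<^sup>+\<omega>. ennreal (Y m \<omega>) \<partial>M) \<le> ennreal (C\<^sup>2 * inverse (real (Suc m) ^ 2))" for m
  proof -
    have "(\<integral>\<^sup>+\<omega>. ennreal (Y m \<omega>) \<partial>M) = ennreal (expectation (Y m))"
      unfolding Y_def power_divide using int_sq by (intro nn_integral_eq_integral) auto
    also have "expectation (Y m) = expectation (\<lambda>\<omega>. (S ((Suc m)\<^sup>2) \<omega>)\<^sup>2) / (real ((Suc m)\<^sup>2))\<^sup>2"
      unfolding Y_def power_divide by simp
    also have "\<dots> \<le> C\<^sup>2 * real ((Suc m)\<^sup>2) / (real ((Suc m)\<^sup>2))\<^sup>2"
      by (intro divide_right_mono second_moment) simp
    also have "\<dots> = C\<^sup>2 * inverse (real (Suc m) ^ 2)"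
      by (cases "real ((Suc m)\<^sup>2) = 0")
         (simp_all add: power2_eq_square[of "real ((Suc m)\<^sup>2)"] divide_inverse mult.assoc
           del: of_nat_Suc of_nat_power, simp add: of_nat_power)
    finally show ?thesis by (simp add: ennreal_leI)
  qed
  have "(\<integral>\<^sup>+\<omega>. (\<Sum>m. ennreal (Y m \<omega>)) \<partial>M) = (\<Sum>m. \<integral>\<^sup>+\<omega>. ennreal (Y m \<omega>) \<partial>M)"
    by (rule nn_integral_suminf) measurable
  also have "\<dots> \<le> (\<Sum>m. ennreal (C\<^sup>2 * inverse (real (Suc m) ^ 2)))"
    by (intro suminf_le Y_int) auto
  also have "\<dots> < \<infinity>"
  proof -
    have "summable (\<lambda>m. C\<^sup>2 * inverse (real (Suc m) ^ 2))"
      using inverse_power_summable[of 2, where 'a = real]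
      by (intro summable_mult) (subst summable_Suc_iff, simp)
    then show ?thesis by (subst suminf_ennreal2) auto
  qed
  finally have "(\<integral>\<^sup>+\<omega>. (\<Sum>m. ennreal (Y m \<omega>)) \<partial>M) \<noteq> \<infinity>" by simp
  then have "AE \<omega> in M. (\<Sum>m. ennreal (Y m \<omega>)) \<noteq> \<infinity>"
    by (intro nn_integral_PInf_AE) auto
  then show ?thesis
  proof (eventually_elim)
    case (elim \<omega>)
    have "summable (\<lambda>m. Y m \<omega>)"
      using elim by (intro summable_suminf_not_top) (auto simp: Y_def)
    then have "(\<lambda>m. Y m \<omega>) \<longlonglongrightarrow> 0" by (rule summable_LIMSEQ_zero)
    then have "(\<lambda>m. sqrt (Y m \<omega>)) \<longlonglongrightarrow> sqrt 0" by (rule tendsto_real_sqrt)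
    then have "(\<lambda>m. \<bar>S ((Suc m)\<^sup>2) \<omega> / real ((Suc m)\<^sup>2)\<bar>) \<longlonglongrightarrow> 0"
      by (simp add: Y_def)
    then have sub: "(\<lambda>m. \<bar>S (m\<^sup>2) \<omega> / real (m\<^sup>2)\<bar>) \<longlonglongrightarrow> 0"
      by (rule LIMSEQ_imp_Suc)
    have lin: "(\<lambda>m. 2 * C / real m) \<longlonglongrightarrow> 0"
      by (rule lim_const_over_n)
    have fs: "filterlim floor_sqrt at_top sequentially"
      unfolding filterlim_at_top
    proof
      fix m :: nat
      show "\<forall>\<^sub>F n in sequentially. m \<le> floor_sqrt n"
        using eventually_ge_at_top[of "m\<^sup>2"]
        by eventually_elim (simp add: le_floor_sqrt_iff)
    qed
    have *: "(\<lambda>n. \<bar>S ((floor_sqrt n)\<^sup>2) \<omega> / real ((floor_sqrt n)\<^sup>2)\<bar> + 2 * C / real (floor_sqrt n)) \<longlonglongrightarrow> 0"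
      using tendsto_add[OF filterlim_compose[OF sub fs] filterlim_compose[OF lin fs]] by simp
    have "(\<lambda>n. S n \<omega> / real n) \<longlonglongrightarrow> 0"
    proof (rule Lim_null_comparison[OF _ *])
      show "\<forall>\<^sub>F n in sequentially. norm (S n \<omega> / real n)
          \<le> \<bar>S ((floor_sqrt n)\<^sup>2) \<omega> / real ((floor_sqrt n)\<^sup>2)\<bar> + 2 * C / real (floor_sqrt n)"
        using eventually_gt_at_top[of 0]
      proof eventually_elim
        case (elim n)
        define m where "m = floor_sqrt n"
        have m0: "m > 0" using elim by (simp add: m_def)
        have le: "m\<^sup>2 \<le> n" by (simp add: m_def)
        have "n < (Suc m)\<^sup>2" using Suc_floor_sqrt_power2_gt[of n] by (simp add: m_def)
        \<comment> \<open>Fewer than \<open>2 * m + 1\<close> increments separate \<open>n\<close>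
          from the square below it. Each is at most \<open>C\<close>, so after division by
          \<open>n\<close>, which is at least the square of \<open>m\<close>, the gap costs at most
          \<open>2 * C / m\<close>.\<close>
        then have "n \<le> m\<^sup>2 + 2 * m" by (simp add: power2_eq_square)
        then have "real n \<le> real (m\<^sup>2 + 2 * m)" by (rule of_nat_mono)
        then have "real n - real (m\<^sup>2) \<le> 2 * real m" by simp
        then have "\<bar>S n \<omega> - S (m\<^sup>2) \<omega>\<bar> \<le> C * (2 * real m)"
          using S_diff[OF le, of \<omega>] C0 by (meson mult_left_mono order_trans)
        then have "\<bar>S n \<omega>\<bar> \<le> \<bar>S (m\<^sup>2) \<omega>\<bar> + 2 * C * real m" by linarith
        then have "\<bar>S n \<omega>\<bar> / real n \<le> (\<bar>S (m\<^sup>2) \<omega>\<bar> + 2 * C * real m) / real n"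
          by (rule divide_right_mono) simp
        also have "\<dots> \<le> (\<bar>S (m\<^sup>2) \<omega>\<bar> + 2 * C * real m) / real (m\<^sup>2)"
          using le m0 C0 elim by (intro divide_left_mono) (auto simp del: of_nat_power)
        also have "\<dots> = \<bar>S (m\<^sup>2) \<omega> / real (m\<^sup>2)\<bar> + 2 * C / real m"
          using m0 by (simp add: add_divide_distrib power2_eq_square)
        finally show ?case by (simp add: m_def)
      qed
    qed
    then show ?case unfolding S_def .
  qed
qed

section \<open>The chain of windows and its stationary weight\<close>

text \<open>The Markov operator of the window chain, acting on functions rather than on measures.
  The oldest jump sits at the head and is discarded; the new one is appended at the end.\<close>

definition transfer :: "(nat \<Rightarrow> real) \<Rightarrow> (bool list \<Rightarrow> real) \<Rightarrow> bool list \<Rightarrow> real" where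
  "transfer q \<phi> w = q (count_list w True) * \<phi> (tl w @ [True])
     + (1 - q (count_list w True)) * \<phi> (tl w @ [False])"

text \<open>Unnormalised weight of a single window, obtained by iterating the balance equation from
  \<open>1 / (1 - q 0)\<close>. The number of windows with \<open>s\<close> ones enters later as a
  binomial coefficient.\<close>

definition stationary_weight :: "(nat \<Rightarrow> real) \<Rightarrow> nat \<Rightarrow> real" where
  "stationary_weight q s = (\<Prod>u<s. q u / (1 - q u)) / (1 - q s)"

definition windows :: "nat \<Rightarrow> bool list set" where
  "windows N = {w. length w = N}"

definition stationary_mean :: "(nat \<Rightarrow> real) \<Rightarrow> nat \<Rightarrow> (bool list \<Rightarrow> real) \<Rightarrow> real" where
  "stationary_mean q N \<phi> = (\<Sum>w\<in>windows N. stationary_weight q (count_list w True) * \<phi> w)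
     / (\<Sum>w\<in>windows N. stationary_weight q (count_list w True))"

lemma finite_windows [simp]: "finite (windows N)"
  using finite_lists_length_eq[of "UNIV :: bool set" N] by (simp add: windows_def)

lemma windows_nonempty: "windows N \<noteq> {}"
  using Ex_list_of_length[of N] by (auto simp: windows_def)

lemma shift_window: "w \<in> windows N \<Longrightarrow> 0 < N \<Longrightarrow> tl w @ [b] \<in> windows N"
  by (auto simp: windows_def)

text \<open>Needed together with its counterpart \<open>sum_windows_Suc_snoc\<close>: for
  invariance, windows before a step are split at the oldest bit and windows after it at the
  newest.\<close>

lemma sum_windows_Suc_Cons:
  "(\<Sum>w\<in>windows (Suc N). F w) = (\<Sum>v\<in>windows N. F (True # v) + F (False # v))"
proof -
  have "windows (Suc N) = Cons True ` windows N \<union> Cons False ` windows N"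
    by (auto simp: windows_def length_Suc_conv image_iff)
  then have "(\<Sum>w\<in>windows (Suc N). F w)
      = (\<Sum>w\<in>Cons True ` windows N. F w) + (\<Sum>w\<in>Cons False ` windows N. F w)"
    by (simp only:) (rule sum.union_disjoint, auto)
  then show ?thesis by (simp add: sum.reindex sum.distrib)
qed

lemma sum_windows_Suc_snoc:
  "(\<Sum>w\<in>windows (Suc N). F w) = (\<Sum>v\<in>windows N. F (v @ [True]) + F (v @ [False]))"
proof -
  have "w \<in> (\<lambda>v. v @ [True]) ` windows N \<union> (\<lambda>v. v @ [False]) ` windows N"
    if "w \<in> windows (Suc N)" for w
    using that by (cases w rule: rev_cases; cases "last w") (auto simp: windows_def)
  then have "windows (Suc N) = (\<lambda>v. v @ [True]) ` windows N \<union> (\<lambda>v. v @ [False]) ` windows N"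
    by (auto simp: windows_def)
  then have "(\<Sum>w\<in>windows (Suc N). F w)
      = (\<Sum>w\<in>(\<lambda>v. v @ [True]) ` windows N. F w) + (\<Sum>w\<in>(\<lambda>v. v @ [False]) ` windows N. F w)"
    by (simp only:) (rule sum.union_disjoint, auto)
  then show ?thesis by (simp add: sum.reindex sum.distrib inj_on_def)
qed

text \<open>Prepending a bit either raises the count by one or keeps it, which gives Pascal's rule;
  the extra summand at \<open>Suc N\<close> vanishes with its binomial coefficient.\<close>

lemma sum_windows_count:
  fixes F :: "nat \<Rightarrow> real"
  shows "(\<Sum>w\<in>windows N. F (count_list w True)) = (\<Sum>s\<le>N. real (N choose s) * F s)"
proof (induction N arbitrary: F)
  case 0
  have "windows 0 = {[]}" by (auto simp: windows_def)
  then show ?case by simp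
next
  case (Suc N)
  have "(\<Sum>w\<in>windows (Suc N). F (count_list w True))
      = (\<Sum>s\<le>N. real (N choose s) * F (Suc s)) + (\<Sum>s\<le>N. real (N choose s) * F s)"
    using Suc[of "\<lambda>s. F (Suc s)"] Suc[of F] by (simp add: sum_windows_Suc_Cons sum.distrib)
  also have "(\<Sum>s\<le>N. real (N choose s) * F s)
      = F 0 + (\<Sum>s\<le>N. real (N choose Suc s) * F (Suc s))"
  proof -
    have "(\<Sum>s\<le>N. real (N choose s) * F s) = (\<Sum>s\<le>Suc N. real (N choose s) * F s)"
      by simp
    then show ?thesis by (simp only: sum.atMost_Suc_shift) simp
  qed
  also have "(\<Sum>s\<le>N. real (N choose s) * F (Suc s))
      + (F 0 + (\<Sum>s\<le>N. real (N choose Suc s) * F (Suc s)))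
      = (\<Sum>s\<le>Suc N. real (Suc N choose s) * F s)"
    by (simp only: sum.atMost_Suc_shift) (simp add: sum.distrib algebra_simps)
  finally show ?case .
qed

text \<open>Bounds for every \<open>s\<close>, also beyond \<open>N\<close>, spare range conditions
  on counts; the instance \<open>jump_prob\<close> is total for this reason.\<close>

locale jump_probabilities =
  fixes q :: "nat \<Rightarrow> real" and e :: real and N :: nat
  assumes N_pos: "0 < N" and e_pos: "0 < e"
    and q_lower: "\<And>s. e \<le> q s" and q_upper: "\<And>s. q s \<le> 1 - e"
begin

lemma q_pos: "0 < q s" and q_less_1: "q s < 1"
  using e_pos q_lower[of s] q_upper[of s] by linarith+

lemma stationary_weight_pos: "0 < stationary_weight q s"
  unfolding stationary_weight_def using q_pos q_less_1 by (intro divide_pos_pos prod_pos) auto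

text \<open>
  Detailed balance for the number of ones: it makes the weight of a window depend only on its
  number of ones.
\<close>

lemma stationary_weight_balance:
  "stationary_weight q (Suc s) * (1 - q (Suc s)) = stationary_weight q s * q s"
  using q_less_1[of s] q_less_1[of "Suc s"] by (simp add: stationary_weight_def)

lemma sum_stationary_weight_pos:
  "0 < (\<Sum>w\<in>windows N. stationary_weight q (count_list w True))"
  using stationary_weight_pos windows_nonempty by (intro sum_pos) auto

text \<open>For a common block \<open>v\<close> of \<open>n\<close> bits, the windows
  \<open>True # v\<close> and \<open>False # v\<close> are exactly the predecessors of
  \<open>v @ [True]\<close> and \<open>v @ [False]\<close>. The contributions of each block agree
  separately.\<close>

lemma stationary_mean_transfer: "stationary_mean q N (transfer q \<phi>) = stationary_mean q N \<phi>"
proof -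
  obtain n where N: "N = Suc n" using N_pos by (cases N) auto
  let ?f = "stationary_weight q"
  have "(\<Sum>w\<in>windows N. ?f (count_list w True) * transfer q \<phi> w)
      = (\<Sum>w\<in>windows N. ?f (count_list w True) * \<phi> w)"
    unfolding N
  proof (subst sum_windows_Suc_Cons, subst sum_windows_Suc_snoc, rule sum.cong)
    fix v assume "v \<in> windows n"
    define s where "s = count_list v True"
    have "?f (Suc s) * (1 - q (Suc s)) = ?f s * q s" by (rule stationary_weight_balance)
    \<comment> \<open>With \<open>a\<close> and \<open>b\<close> the values of \<open>\<phi>\<close>
      at the two successors, the two sides differ by \<open>b - a\<close> times the defect in the
      balance equation.\<close>
    moreover have "?f (Suc s) * (q (Suc s) * a + (1 - q (Suc s)) * b)
          + ?f s * (q s * a + (1 - q s) * b)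
        = ?f (Suc s) * a + ?f s * b + (b - a) * (?f (Suc s) * (1 - q (Suc s)) - ?f s * q s)" for a b
      by (simp add: algebra_simps)
    ultimately show "?f (count_list (True # v) True) * transfer q \<phi> (True # v)
        + ?f (count_list (False # v) True) * transfer q \<phi> (False # v)
      = ?f (count_list (v @ [True]) True) * \<phi> (v @ [True])
        + ?f (count_list (v @ [False]) True) * \<phi> (v @ [False])"
      by (simp add: transfer_def s_def)
  qed simp
  then show ?thesis by (simp add: stationary_mean_def)
qed

lemma stationary_mean_transfer_funpow:
  "stationary_mean q N ((transfer q ^^ k) \<phi>) = stationary_mean q N \<phi>"
  by (induction k) (simp_all add: stationary_mean_transfer)

lemma stationary_mean_bounds:
  assumes "\<And>w. w \<in> windows N \<Longrightarrow> a \<le> \<phi> w" and "\<And>w. w \<in> windows N \<Longrightarrow> \<phi> w \<le> b"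
  shows "a \<le> stationary_mean q N \<phi>" and "stationary_mean q N \<phi> \<le> b"
proof -
  let ?f = "\<lambda>w. stationary_weight q (count_list w True)"
  have "(\<Sum>w\<in>windows N. ?f w * a) \<le> (\<Sum>w\<in>windows N. ?f w * \<phi> w)"
    using assms(1) stationary_weight_pos by (intro sum_mono mult_left_mono) (auto intro: less_imp_le)
  moreover have "(\<Sum>w\<in>windows N. ?f w * \<phi> w) \<le> (\<Sum>w\<in>windows N. ?f w * b)"
    using assms(2) stationary_weight_pos by (intro sum_mono mult_left_mono) (auto intro: less_imp_le)
  ultimately show "a \<le> stationary_mean q N \<phi>" "stationary_mean q N \<phi> \<le> b"
    using sum_stationary_weight_pos
    by (simp_all add: stationary_mean_def pos_le_divide_eq pos_divide_le_eq
        sum_distrib_left mult.commute)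
qed

lemma transfer_ge:
  assumes "w \<in> windows N" and "\<And>w. w \<in> windows N \<Longrightarrow> a \<le> \<phi> w"
  shows "a \<le> transfer q \<phi> w"
proof -
  define s where "s = count_list w True"
  have "a \<le> \<phi> (tl w @ [b])" for b
    using shift_window[OF assms(1) N_pos] by (rule assms(2))
  then have "q s * a + (1 - q s) * a \<le> q s * \<phi> (tl w @ [True]) + (1 - q s) * \<phi> (tl w @ [False])"
    using q_pos[of s] q_less_1[of s] by (intro add_mono mult_left_mono) auto
  then show ?thesis by (simp add: transfer_def s_def algebra_simps)
qed

lemma transfer_funpow_ge:
  assumes "\<And>w. w \<in> windows N \<Longrightarrow> a \<le> \<phi> w"
  shows "w \<in> windows N \<Longrightarrow> a \<le> (transfer q ^^ k) \<phi> w"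
proof (induction k arbitrary: w)
  case (Suc k)
  then show ?case using transfer_ge[of w a "(transfer q ^^ k) \<phi>"] by simp
qed (use assms in simp)

lemma transfer_uminus: "transfer q (\<lambda>w. - \<phi> w) = (\<lambda>w. - transfer q \<phi> w)"
  by (auto simp: transfer_def algebra_simps)

lemma transfer_funpow_uminus: "(transfer q ^^ k) (\<lambda>w. - \<phi> w) = (\<lambda>w. - (transfer q ^^ k) \<phi> w)"
  by (induction k) (simp_all add: transfer_uminus)

lemma transfer_funpow_le:
  assumes "\<And>w. w \<in> windows N \<Longrightarrow> \<phi> w \<le> b" and "w \<in> windows N"
  shows "(transfer q ^^ k) \<phi> w \<le> b"
  using transfer_funpow_ge[of "- b" "\<lambda>w. - \<phi> w" w k] assms by (simp add: transfer_funpow_uminus)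

text \<open>
  The bits of \<open>v\<close> can be appended one by one, each with probability at least \<open>e\<close>.
\<close>

lemma transfer_funpow_minorization:
  assumes "\<And>w. w \<in> windows N \<Longrightarrow> a \<le> \<phi> w"
  shows "length v = k \<Longrightarrow> k \<le> N \<Longrightarrow> w \<in> windows N \<Longrightarrow>
    a + e ^ k * (\<phi> (drop k w @ v) - a) \<le> (transfer q ^^ k) \<phi> w"
proof (induction k arbitrary: v w)
  case (Suc k)
  obtain c v' where v: "v = c # v'" using Suc.prems(1) by (cases v) auto
  let ?g = "(transfer q ^^ k) \<phi>"
  define y where "y = ?g (tl w @ [c]) - a"
  have ge: "a \<le> ?g (tl w @ [b])" for b
    using assms Suc.prems(3) N_pos by (intro transfer_funpow_ge shift_window) auto
  have len: "length w = N" using Suc.prems(3) by (simp add: windows_def)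
  have "drop k (tl w @ [c]) @ v' = drop (Suc k) w @ v"
    using Suc.prems(2) len by (simp add: v drop_Suc tl_drop)
  moreover have "a + e ^ k * (\<phi> (drop k (tl w @ [c]) @ v') - a) \<le> ?g (tl w @ [c])"
    using Suc.prems N_pos by (intro Suc.IH shift_window) (auto simp: v)
  ultimately have "e ^ k * (\<phi> (drop (Suc k) w @ v) - a) \<le> y" by (simp add: y_def)
  then have "a + e ^ Suc k * (\<phi> (drop (Suc k) w @ v) - a) \<le> a + e * y"
    using e_pos by (simp add: mult.assoc)
  also have "\<dots> \<le> transfer q ?g w"
  proof -
    define s where "s = count_list w True"
    have "0 \<le> y" using ge[of c] by (simp add: y_def)
    then have "e * y \<le> q s * y" "e * y \<le> (1 - q s) * y"
      using q_lower[of s] q_upper[of s] by (auto intro!: mult_right_mono)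
    moreover have "0 \<le> q s * (?g (tl w @ [True]) - a)" "0 \<le> (1 - q s) * (?g (tl w @ [False]) - a)"
      using q_pos[of s] q_less_1[of s] ge by (auto intro!: mult_nonneg_nonneg)
    ultimately show ?thesis
      by (cases c) (simp_all add: y_def transfer_def s_def algebra_simps)
  qed
  finally show ?case by simp
qed simp

text \<open>Doeblin contraction in rounds of \<open>N\<close> steps. If some window has a value at
  or above the midpoint of \<open>[a, b]\<close>, every window reaches it with probability at least
  \<open>e ^ N\<close>, which lifts the lower bound by \<open>e ^ N * (b - a) / 2\<close>. Otherwise
  all values lie below the midpoint, and the upper bound drops by half the length, at least as much
  since \<open>e ^ N\<close> is at most 1.\<close>

lemma transfer_funpow_oscillation:
  assumes C: "\<And>v w. v \<in> windows N \<Longrightarrow> w \<in> windows N \<Longrightarrow> \<phi> v - \<phi> w \<le> C"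
  shows "\<exists>a b. (\<forall>w\<in>windows N. a \<le> (transfer q ^^ (N * k)) \<phi> w \<and> (transfer q ^^ (N * k)) \<phi> w \<le> b)
    \<and> b - a \<le> (1 - e ^ N / 2) ^ k * C"
proof (induction k)
  case 0
  have im: "finite (\<phi> ` windows N)" "\<phi> ` windows N \<noteq> {}" using windows_nonempty by auto
  obtain v where v: "v \<in> windows N" "Max (\<phi> ` windows N) = \<phi> v"
    using Max_in[OF im] by auto
  obtain w where w: "w \<in> windows N" "Min (\<phi> ` windows N) = \<phi> w"
    using Min_in[OF im] by auto
  have "\<phi> w \<le> \<phi> u \<and> \<phi> u \<le> \<phi> v" if "u \<in> windows N" for u
    using that im by (metis v(2) w(2) Max_ge Min_le imageI)
  then show ?case
    using C[OF v(1) w(1)] by (intro exI[of _ "\<phi> w"] exI[of _ "\<phi> v"]) auto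
next
  case (Suc k)
  let ?g = "(transfer q ^^ (N * k)) \<phi>"
  obtain a b where ab: "\<And>w. w \<in> windows N \<Longrightarrow> a \<le> ?g w" "\<And>w. w \<in> windows N \<Longrightarrow> ?g w \<le> b"
    "b - a \<le> (1 - e ^ N / 2) ^ k * C"
    using Suc by blast
  have eq: "(transfer q ^^ (N * Suc k)) \<phi> = (transfer q ^^ N) ?g"
    by (simp add: funpow_add)
  obtain w0 where w0: "w0 \<in> windows N" using windows_nonempty by blast
  have "e \<le> 1" using e_pos q_lower[of 0] q_upper[of 0] by linarith
  then have eN: "0 < e ^ N" "e ^ N \<le> 1" using e_pos by (auto intro: power_le_one)
  have ab_le: "a \<le> b" using ab(1)[OF w0] ab(2)[OF w0] by linarith
  have contract: "(1 - e ^ N / 2) * (b - a) \<le> (1 - e ^ N / 2) ^ Suc k * C"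
    using ab(3) eN mult_left_mono[of "b - a" "(1 - e ^ N / 2) ^ k * C" "1 - e ^ N / 2"]
    by (simp add: mult.assoc)
  show ?case
  proof (cases "\<exists>v\<in>windows N. (a + b) / 2 \<le> ?g v")
    case True
    then obtain v where v: "v \<in> windows N" "(a + b) / 2 \<le> ?g v" by blast
    have "a + e ^ N * ((b - a) / 2) \<le> (transfer q ^^ N) ?g w" if w: "w \<in> windows N" for w
    proof -
      \<comment> \<open>After \<open>N\<close> steps nothing of the starting window is left, so the
        bound depends only on the target \<open>v\<close>.\<close>
      have "a + e ^ N * (?g v - a) \<le> (transfer q ^^ N) ?g w"
        using transfer_funpow_minorization[of a ?g v N w] ab(1) v w by (auto simp: windows_def)
      moreover have "e ^ N * ((b - a) / 2) \<le> e ^ N * (?g v - a)"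
        using v(2) eN by (intro mult_left_mono) (auto simp: field_simps)
      ultimately show ?thesis by linarith
    qed
    moreover have "(transfer q ^^ N) ?g w \<le> b" if "w \<in> windows N" for w
      using ab(2) that by (rule transfer_funpow_le)
    moreover have "b - (a + e ^ N * ((b - a) / 2)) \<le> (1 - e ^ N / 2) ^ Suc k * C"
      using contract by (simp add: algebra_simps)
    ultimately show ?thesis unfolding eq by blast
  next
    case False
    then have "?g w \<le> (a + b) / 2" if "w \<in> windows N" for w
      using that by (meson linear)
    then have "(transfer q ^^ N) ?g w \<le> (a + b) / 2" if "w \<in> windows N" for w
      using that by (rule transfer_funpow_le)
    moreover have "a \<le> (transfer q ^^ N) ?g w" if "w \<in> windows N" for w
      using ab(1) that by (rule transfer_funpow_ge)
    moreover have "(a + b) / 2 - a \<le> (1 - e ^ N / 2) ^ Suc k * C"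
    proof -
      have "(a + b) / 2 - a = 1 / 2 * (b - a)" by (simp add: field_simps)
      also have "\<dots> \<le> (1 - e ^ N / 2) * (b - a)" using eN ab_le by (intro mult_right_mono) auto
      finally show ?thesis using contract by linarith
    qed
    ultimately show ?thesis unfolding eq by blast
  qed
qed

text \<open>The stationary mean of an iterate is that of \<open>\<phi>\<close> itself, and as a
  weighted average it lies in the same shrinking interval as the values of the iterate.\<close>

lemma transfer_funpow_approx:
  assumes "0 < \<epsilon>"
  shows "\<exists>k. \<forall>w\<in>windows N. \<bar>(transfer q ^^ k) \<phi> w - stationary_mean q N \<phi>\<bar> \<le> \<epsilon>"
proof -
  define C where "C = Max (\<phi> ` windows N) - Min (\<phi> ` windows N)"
  have C: "\<phi> v - \<phi> w \<le> C" if "v \<in> windows N" "w \<in> windows N" for v w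
    unfolding C_def using that by (intro diff_mono) auto
  have "e \<le> 1" using e_pos q_lower[of 0] q_upper[of 0] by linarith
  then have eN: "0 < e ^ N" "e ^ N \<le> 1" using e_pos by (auto intro: power_le_one)
  then have "(\<lambda>k. (1 - e ^ N / 2) ^ k * C) \<longlonglongrightarrow> 0 * C"
    by (intro tendsto_mult LIMSEQ_power_zero tendsto_const) auto
  then have "\<forall>\<^sub>F k in sequentially. (1 - e ^ N / 2) ^ k * C < \<epsilon>"
    using assms by (intro order_tendstoD) auto
  then obtain k where k: "(1 - e ^ N / 2) ^ k * C < \<epsilon>"
    by (auto simp: eventually_sequentially)
  let ?g = "(transfer q ^^ (N * k)) \<phi>"
  obtain a b where ab: "\<And>w. w \<in> windows N \<Longrightarrow> a \<le> ?g w" "\<And>w. w \<in> windows N \<Longrightarrow> ?g w \<le> b"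
    "b - a \<le> (1 - e ^ N / 2) ^ k * C"
    using transfer_funpow_oscillation[of \<phi> C k] C by blast
  have "a \<le> stationary_mean q N \<phi>" "stationary_mean q N \<phi> \<le> b"
    using stationary_mean_bounds[of a ?g b] ab by (simp_all add: stationary_mean_transfer_funpow)
  then have "\<bar>?g w - stationary_mean q N \<phi>\<bar> \<le> \<epsilon>" if "w \<in> windows N" for w
    using ab(1)[OF that] ab(2)[OF that] ab(3) k by linarith
  then show ?thesis by blast
qed

end

section \<open>Ergodic averages\<close>

definition history :: "(nat \<Rightarrow> 'a \<Rightarrow> bool) \<Rightarrow> nat \<Rightarrow> 'a \<Rightarrow> bool list" where
  "history B n \<omega> = map (\<lambda>k. B k \<omega>) [0..<n]"

lemma length_history [simp]: "length (history B n \<omega>) = n"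
  by (simp add: history_def)

lemma history_eq_iff:
  assumes "length w = n"
  shows "history B n \<omega> = w \<longleftrightarrow> (\<forall>k<n. B k \<omega> = w ! k)"
proof -
  have "history B n \<omega> = w \<longleftrightarrow> (\<forall>k<n. history B n \<omega> ! k = w ! k)"
    unfolding list_eq_iff_nth_eq length_history using assms by blast
  moreover have "history B n \<omega> ! k = B k \<omega>" if "k < n" for k
    using that by (simp add: history_def)
  ultimately show ?thesis by metis
qed

lemma history_Suc: "history B (Suc n) \<omega> = history B n \<omega> @ [B n \<omega>]"
  by (simp add: history_def)

lemma take_history: "k \<le> n \<Longrightarrow> take k (history B n \<omega>) = history B k \<omega>"
  by (simp add: history_def take_map)

text \<open>The transition law is multiplied out instead of being written with conditional
  probabilities, so histories of probability 0 need no separate treatment.\<close>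

locale recent_history_chain = prob_space M + jump_probabilities q e N
  for M :: "'a measure" and q e N +
  fixes B :: "nat \<Rightarrow> 'a \<Rightarrow> bool"
  assumes B_measurable: "\<And>n. B n \<in> measurable M (count_space UNIV)"
    and step: "\<And>n w. N \<le> n \<Longrightarrow> length w = n \<Longrightarrow>
      prob {\<omega>\<in>space M. history B n \<omega> = w \<and> B n \<omega>}
        = q (count_list (drop (n - N) w) True) * prob {\<omega>\<in>space M. history B n \<omega> = w}"
begin

text \<open>Histories list the oldest jump first. For \<open>n < N\<close> truncated subtraction
  returns the whole, shorter history, hence the condition \<open>N \<le> n\<close> in the facts
  below.\<close>

definition window :: "nat \<Rightarrow> 'a \<Rightarrow> bool list" where
  "window n \<omega> = drop (n - N) (history B n \<omega>)"

lemma window_in: "N \<le> n \<Longrightarrow> window n \<omega> \<in> windows N"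
  by (simp add: window_def windows_def)

lemma window_Suc: "N \<le> n \<Longrightarrow> window (Suc n) \<omega> = tl (window n \<omega>) @ [B n \<omega>]"
proof -
  assume "N \<le> n"
  then have "Suc n - N = Suc (n - N)" "Suc (n - N) - n = 0" using N_pos by auto
  then have "window (Suc n) \<omega> = drop (Suc (n - N)) (history B n \<omega>) @ [B n \<omega>]"
    unfolding window_def history_Suc drop_append length_history by (simp only: drop_0)
  then show ?thesis unfolding window_def drop_Suc tl_drop .
qed

lemma history_measurable [measurable]: "history B n \<in> measurable M (count_space UNIV)"
proof -
  note B_measurable [measurable]
  have "history B n -` {w} \<inter> space M \<in> sets M" for w
  proof (cases "length w = n")
    case True
    then have "history B n \<omega> = w \<longleftrightarrow> (\<forall>k\<in>{..<n}. B k \<omega> = w ! k)" for \<omega>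
      unfolding Ball_def lessThan_iff by (rule history_eq_iff)
    then have "history B n -` {w} \<inter> space M = {\<omega>\<in>space M. \<forall>k\<in>{..<n}. B k \<omega> = w ! k}"
      by blast
    also have "\<dots> \<in> sets M" by measurable
    finally show ?thesis .
  next
    case False
    then have "history B n -` {w} \<inter> space M = {}" by fastforce
    then show ?thesis by simp
  qed
  then show ?thesis by (subst measurable_count_space_eq2_countable) auto
qed

lemma history_function_measurable:
  fixes F :: "bool list \<Rightarrow> real"
  shows "(\<lambda>\<omega>. F (history B n \<omega>)) \<in> borel_measurable M"
  by (rule measurable_compose[OF history_measurable]) simp

text \<open>The martingale difference property, tested against functions of the past. Conditional
  expectations are replaced by a finite sum over all histories of length \<open>n\<close>, the set
  \<open>windows n\<close>; each summand is 0 by \<open>step\<close>.\<close>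

lemma expectation_jump_increment:
  fixes F :: "bool list \<Rightarrow> real"
  assumes "N \<le> n"
  shows "expectation (\<lambda>\<omega>. F (history B n \<omega>)
    * (of_bool (B n \<omega>) - q (count_list (window n \<omega>) True))) = 0"
proof -
  note B_measurable [measurable]
  let ?Q = "\<lambda>w. q (count_list (drop (n - N) w) True)"
  let ?H = "\<lambda>w. {\<omega>\<in>space M. history B n \<omega> = w}"
  let ?J = "\<lambda>w. {\<omega>\<in>space M. history B n \<omega> = w \<and> B n \<omega>}"
  have H: "?H w \<in> sets M" for w
    using measurable_sets[OF history_measurable, of "{w}" n] by (simp add: vimage_def Int_def conj_commute)
  have J: "?J w \<in> sets M" for w
  proof -
    have "?J w = ?H w \<inter> {\<omega>\<in>space M. B n \<omega>}" by auto
    moreover have "{\<omega>\<in>space M. B n \<omega>} \<in> sets M" by measurable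
    ultimately show ?thesis using H[of w] by auto
  qed
  have "expectation (\<lambda>\<omega>. F (history B n \<omega>) * (of_bool (B n \<omega>) - q (count_list (window n \<omega>) True)))
      = expectation (\<lambda>\<omega>. \<Sum>w\<in>windows n. F w * (indicator (?J w) \<omega> - ?Q w * indicator (?H w) \<omega>))"
  proof (rule Bochner_Integration.integral_cong)
    fix \<omega> assume \<omega>: "\<omega> \<in> space M"
    define h where "h = history B n \<omega>"
    have hw: "h \<in> windows n" by (simp add: h_def windows_def)
    have "(\<Sum>w\<in>windows n. F w * (indicator (?J w) \<omega> - ?Q w * indicator (?H w) \<omega>))
        = (\<Sum>w\<in>windows n. if w = h then F h * (of_bool (B n \<omega>) - ?Q h) else 0)"
      using \<omega> by (intro sum.cong) (auto simp: indicator_def h_def)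
    also have "\<dots> = F h * (of_bool (B n \<omega>) - ?Q h)"
      by (simp add: hw)
    finally show "F (history B n \<omega>) * (of_bool (B n \<omega>) - q (count_list (window n \<omega>) True))
        = (\<Sum>w\<in>windows n. F w * (indicator (?J w) \<omega> - ?Q w * indicator (?H w) \<omega>))"
      by (simp add: h_def window_def)
  qed simp
  also have "\<dots> = (\<Sum>w\<in>windows n. F w * (prob (?J w) - ?Q w * prob (?H w)))"
    using H J by (subst Bochner_Integration.integral_sum) (auto simp: Int_absorb2 emeasure_eq_measure)
  also have "\<dots> = 0"
    using step[OF assms] by (intro sum.neutral) (auto simp: windows_def)
  finally show ?thesis .
qed

text \<open>The increment equals the centred jump indicator times \<open>G\<close>, the difference
  of \<open>\<phi>\<close> at the two possible successors. It is thus bounded and orthogonal to all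
  functions of the past.\<close>

lemma transfer_increment_average:
  "AE \<omega> in M. (\<lambda>n. (\<Sum>k\<in>{N..<n}. \<phi> (window (Suc k) \<omega>) - transfer q \<phi> (window k \<omega>)) / real n)
    \<longlonglongrightarrow> 0"
proof -
  define G where "G w = \<phi> (tl w @ [True]) - \<phi> (tl w @ [False])" for w
  \<comment> \<open>Writes the increment as a function of the history of length
    \<open>Suc k\<close>; \<open>butlast\<close> recovers the history before the jump. This form
    yields measurability and lets past increments be read off a longer history.\<close>
  define D where "D k h = (if k < N then 0 else
    \<phi> (drop (Suc k - N) h) - transfer q \<phi> (drop (k - N) (butlast h)))" for k and h :: "bool list"
  define d where "d k \<omega> = D k (history B (Suc k) \<omega>)" for k \<omega>
  have d_eq: "d k \<omega> = (if k < N then 0 else \<phi> (window (Suc k) \<omega>) - transfer q \<phi> (window k \<omega>))" for k \<omega>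
    by (simp add: d_def D_def window_def history_Suc)
  have d_eq2: "d k \<omega> = G (window k \<omega>) * (of_bool (B k \<omega>) - q (count_list (window k \<omega>) True))"
    if "N \<le> k" for k \<omega>
    using that by (cases "B k \<omega>") (simp_all add: d_eq window_Suc transfer_def G_def algebra_simps)
  define C where "C = (\<Sum>w\<in>windows N. \<bar>G w\<bar>)"
  have "AE \<omega> in M. (\<lambda>n. (\<Sum>k<n. d k \<omega>) / real n) \<longlonglongrightarrow> 0"
  proof (rule strong_law_orthogonal_sums)
    show "d n \<in> borel_measurable M" for n
      unfolding d_def by (rule history_function_measurable)
    show "\<bar>d n \<omega>\<bar> \<le> C" for n \<omega>
    proof (cases "n < N")
      case True
      then show ?thesis by (simp add: d_eq C_def sum_nonneg)
    next
      case False
      let ?s = "count_list (window n \<omega>) True"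
      have "\<bar>d n \<omega>\<bar> \<le> \<bar>G (window n \<omega>)\<bar> * 1"
        using False q_pos[of ?s] q_less_1[of ?s] unfolding d_eq2[OF leI[OF False]] abs_mult
        by (intro mult_left_mono) auto
      also have "\<dots> \<le> C"
        unfolding C_def using False window_in[of n \<omega>] by (auto intro!: member_le_sum)
      finally show ?thesis .
    qed
    show "expectation (\<lambda>\<omega>. (\<Sum>k<n. d k \<omega>) * d n \<omega>) = 0" for n
    proof (cases "n < N")
      case True
      then show ?thesis by (simp add: d_eq)
    next
      case False
      \<comment> \<open>Past increments and the factor \<open>G\<close> are all determined by the
        first \<open>n\<close> jumps, so their product is a legitimate test function.\<close>
      define F where "F h = (\<Sum>k<n. D k (take (Suc k) h)) * G (drop (n - N) h)" for h
      have "(\<Sum>k<n. d k \<omega>) = (\<Sum>k<n. D k (take (Suc k) (history B n \<omega>)))" for \<omega>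
        by (intro sum.cong) (simp_all add: d_def take_history Suc_leI)
      then have "(\<Sum>k<n. d k \<omega>) * d n \<omega> = F (history B n \<omega>)
          * (of_bool (B n \<omega>) - q (count_list (window n \<omega>) True))" for \<omega>
        using False by (simp add: d_eq2 F_def window_def)
      then show ?thesis using expectation_jump_increment[of n F] False by simp
    qed
  qed
  moreover have "(\<Sum>k<n. d k \<omega>)
      = (\<Sum>k\<in>{N..<n}. \<phi> (window (Suc k) \<omega>) - transfer q \<phi> (window k \<omega>))" for n \<omega>
    unfolding d_eq by (intro sum.mono_neutral_cong_right) auto
  ultimately show ?thesis by simp
qed

lemma window_function_bounded: "\<exists>C. \<forall>n\<ge>N. \<forall>\<omega>. \<bar>\<phi> (window n \<omega>) :: real\<bar> \<le> C"
proof (intro exI allI impI)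
  fix n \<omega> assume "N \<le> n"
  then show "\<bar>\<phi> (window n \<omega>)\<bar> \<le> (\<Sum>w\<in>windows N. \<bar>\<phi> w\<bar>)"
    using window_in[of n \<omega>] by (intro member_le_sum) auto
qed

text \<open>Replacing the next window by the current one changes the sum only by a telescoping
  boundary term, which stays bounded.\<close>

lemma transfer_average:
  "AE \<omega> in M. (\<lambda>n. (\<Sum>k\<in>{N..<n}. \<phi> (window k \<omega>) - transfer q \<phi> (window k \<omega>)) / real n)
    \<longlonglongrightarrow> 0"
  using transfer_increment_average[of \<phi>]
proof (eventually_elim)
  case (elim \<omega>)
  obtain C where C: "\<And>n. N \<le> n \<Longrightarrow> \<bar>\<phi> (window n \<omega>)\<bar> \<le> C"
    using window_function_bounded[of \<phi>] by blast
  have "(\<lambda>n. (\<phi> (window n \<omega>) - \<phi> (window N \<omega>)) / real n) \<longlonglongrightarrow> 0"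
  proof (rule Lim_null_comparison)
    show "(\<lambda>n. 2 * C / real n) \<longlonglongrightarrow> 0" by (rule lim_const_over_n)
    show "\<forall>\<^sub>F n in sequentially. norm ((\<phi> (window n \<omega>) - \<phi> (window N \<omega>)) / real n) \<le> 2 * C / real n"
      using eventually_ge_at_top[of N]
    proof eventually_elim
      case (elim n)
      have "\<bar>\<phi> (window n \<omega>) - \<phi> (window N \<omega>)\<bar> \<le> 2 * C"
        using C[OF elim] C[OF order_refl] by linarith
      then show ?case by (simp add: divide_right_mono)
    qed
  qed
  then have "(\<lambda>n. (\<Sum>k\<in>{N..<n}. \<phi> (window (Suc k) \<omega>) - transfer q \<phi> (window k \<omega>)) / real n
      - (\<phi> (window n \<omega>) - \<phi> (window N \<omega>)) / real n) \<longlonglongrightarrow> 0 - 0"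
    by (intro tendsto_diff elim)
  moreover have "\<forall>\<^sub>F n in sequentially.
      (\<Sum>k\<in>{N..<n}. \<phi> (window (Suc k) \<omega>) - transfer q \<phi> (window k \<omega>)) / real n
      - (\<phi> (window n \<omega>) - \<phi> (window N \<omega>)) / real n
      = (\<Sum>k\<in>{N..<n}. \<phi> (window k \<omega>) - transfer q \<phi> (window k \<omega>)) / real n"
    using eventually_ge_at_top[of N]
  proof eventually_elim
    case (elim n)
    have "(\<Sum>k\<in>{N..<n}. \<phi> (window (Suc k) \<omega>) - \<phi> (window k \<omega>)) = \<phi> (window n \<omega>) - \<phi> (window N \<omega>)"
      using elim by (rule sum_Suc_diff')
    then have "(\<Sum>k\<in>{N..<n}. \<phi> (window k \<omega>) - transfer q \<phi> (window k \<omega>))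
        = (\<Sum>k\<in>{N..<n}. \<phi> (window (Suc k) \<omega>) - transfer q \<phi> (window k \<omega>))
          - (\<phi> (window n \<omega>) - \<phi> (window N \<omega>))"
      by (simp add: sum_subtractf)
    then show ?case by (simp add: diff_divide_distrib)
  qed
  ultimately show ?case by (simp add: tendsto_cong)
qed

lemma window_average:
  "AE \<omega> in M. (\<lambda>n. (\<Sum>k\<in>{N..<n}. \<phi> (window k \<omega>)) / real n) \<longlonglongrightarrow> stationary_mean q N \<phi>"
proof -
  let ?T = "\<lambda>j. (transfer q ^^ j) \<phi>"
  let ?m = "stationary_mean q N \<phi>"
  \<comment> \<open>All iterates are handled on one almost sure event, because the iterate needed
    below depends on the accuracy \<open>r\<close>.\<close>
  have "AE \<omega> in M. \<forall>j. (\<lambda>n. (\<Sum>k\<in>{N..<n}. ?T j (window k \<omega>) - ?T (Suc j) (window k \<omega>)) / real n)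
      \<longlonglongrightarrow> 0"
    unfolding AE_all_countable
  proof
    fix j
    show "AE \<omega> in M. (\<lambda>n. (\<Sum>k\<in>{N..<n}. ?T j (window k \<omega>) - ?T (Suc j) (window k \<omega>)) / real n)
      \<longlonglongrightarrow> 0"
      using transfer_average[of "?T j"] by simp
  qed
  then show ?thesis
  proof (eventually_elim)
    case (elim \<omega>)
    have approx: "(\<lambda>n. (\<Sum>k\<in>{N..<n}. \<phi> (window k \<omega>) - ?T j (window k \<omega>)) / real n) \<longlonglongrightarrow> 0" for j
    proof (induction j)
      case (Suc j)
      show ?case
        using tendsto_add[OF Suc elim[rule_format, of j]]
        by (simp add: add_divide_distrib[symmetric] sum.distrib[symmetric] del: funpow.simps)
    qed simp
    show ?case
    proof (rule LIMSEQ_I)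
      fix r :: real assume r: "0 < r"
      obtain j where j: "\<And>w. w \<in> windows N \<Longrightarrow> \<bar>?T j w - ?m\<bar> \<le> r / 3"
        using transfer_funpow_approx[of "r / 3" \<phi>] r by auto
      have "\<forall>\<^sub>F n in sequentially.
          \<bar>(\<Sum>k\<in>{N..<n}. \<phi> (window k \<omega>) - ?T j (window k \<omega>)) / real n\<bar> < r / 3"
        using r tendstoD[OF approx[of j], of "r / 3"] by simp
      \<comment> \<open>The sum has \<open>n - N\<close> terms but is divided by \<open>n\<close>;
        this term accounts for the missing \<open>N\<close>.\<close>
      moreover have "\<forall>\<^sub>F n in sequentially. \<bar>real N * ?m / real n\<bar> < r / 3"
        using r tendstoD[OF lim_const_over_n[of "real N * ?m"], of "r / 3"] by simp
      ultimately have "\<forall>\<^sub>F n in sequentially.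
        norm ((\<Sum>k\<in>{N..<n}. \<phi> (window k \<omega>)) / real n - ?m) < r"
        using eventually_gt_at_top[of N]
      proof eventually_elim
        case (elim n)
        have "\<bar>\<Sum>k\<in>{N..<n}. ?T j (window k \<omega>) - ?m\<bar> \<le> (\<Sum>k\<in>{N..<n}. \<bar>?T j (window k \<omega>) - ?m\<bar>)"
          by (rule sum_abs)
        also have "\<dots> \<le> (\<Sum>k\<in>{N..<n}. r / 3)"
          by (intro sum_mono j window_in) auto
        also have "\<dots> \<le> real n * (r / 3)"
          using r by (simp add: mult_right_mono)
        finally have 1: "\<bar>(\<Sum>k\<in>{N..<n}. ?T j (window k \<omega>) - ?m) / real n\<bar> \<le> r / 3"
          using elim by (simp add: divide_le_eq mult.commute)
        have "(\<Sum>k\<in>{N..<n}. \<phi> (window k \<omega>)) / real n - ?m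
            = (\<Sum>k\<in>{N..<n}. \<phi> (window k \<omega>) - ?T j (window k \<omega>)) / real n
              + (\<Sum>k\<in>{N..<n}. ?T j (window k \<omega>) - ?m) / real n - real N * ?m / real n"
          using elim by (simp add: sum_subtractf of_nat_diff field_simps)
        moreover have "\<bar>x + y - z\<bar> < r" if "\<bar>x\<bar> < r / 3" "\<bar>y\<bar> \<le> r / 3" "\<bar>z\<bar> < r / 3" for x y z
          using that by linarith
        ultimately show ?case using elim(1,2) 1 by (simp only: real_norm_def)
      qed
      then show "\<exists>no. \<forall>n\<ge>no. norm ((\<Sum>k\<in>{N..<n}. \<phi> (window k \<omega>)) / real n - ?m) < r"
        by (simp add: eventually_sequentially)
    qed
  qed
qed

text \<open>The last bit of the next window is the current jump, and \<open>transfer\<close> turns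
  this bit into \<open>q\<close> of the count. Jumps may therefore be replaced by their
  probabilities, whose average is a stationary mean.\<close>

lemma jump_frequency:
  "AE \<omega> in M. (\<lambda>n. (\<Sum>k<n. of_bool (B k \<omega>)) / real n) \<longlonglongrightarrow>
     (\<Sum>s\<le>N. real (N choose s) * (stationary_weight q s * q s))
       / (\<Sum>s\<le>N. real (N choose s) * stationary_weight q s)"
proof -
  let ?q = "\<lambda>w. q (count_list w True)"
  have mean: "stationary_mean q N ?q = (\<Sum>s\<le>N. real (N choose s) * (stationary_weight q s * q s))
       / (\<Sum>s\<le>N. real (N choose s) * stationary_weight q s)"
    unfolding stationary_mean_def
    by (simp only: sum_windows_count[of "\<lambda>s. stationary_weight q s * q s"]
        sum_windows_count[of "stationary_weight q"])
  have "AE \<omega> in M. (\<lambda>n. (\<Sum>k\<in>{N..<n}. of_bool (B k \<omega>) - ?q (window k \<omega>)) / real n) \<longlonglongrightarrow> 0"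
  proof -
    have "(\<Sum>k\<in>{N..<n}. of_bool (last (window (Suc k) \<omega>)) - transfer q (\<lambda>w. of_bool (last w)) (window k \<omega>))
        = (\<Sum>k\<in>{N..<n}. of_bool (B k \<omega>) - ?q (window k \<omega>))" for n \<omega>
      by (intro sum.cong) (simp_all add: window_Suc transfer_def)
    then show ?thesis using transfer_increment_average[of "\<lambda>w. of_bool (last w)"] by simp
  qed
  with window_average[of ?q] show ?thesis
  proof (eventually_elim)
    case (elim \<omega>)
    have "(\<lambda>n. (\<Sum>k<N. of_bool (B k \<omega>)) / real n) \<longlonglongrightarrow> 0"
      by (rule lim_const_over_n)
    from tendsto_add[OF this tendsto_add[OF elim]]
    have "(\<lambda>n. (\<Sum>k<N. of_bool (B k \<omega>)) / real n + ((\<Sum>k\<in>{N..<n}. ?q (window k \<omega>)) / real n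
       + (\<Sum>k\<in>{N..<n}. of_bool (B k \<omega>) - ?q (window k \<omega>)) / real n)) \<longlonglongrightarrow> stationary_mean q N ?q"
      by simp
    moreover have "\<forall>\<^sub>F n in sequentially.
      (\<Sum>k<N. of_bool (B k \<omega>)) / real n + ((\<Sum>k\<in>{N..<n}. ?q (window k \<omega>)) / real n
       + (\<Sum>k\<in>{N..<n}. of_bool (B k \<omega>) - ?q (window k \<omega>)) / real n)
      = (\<Sum>k<n. of_bool (B k \<omega>)) / real n"
      using eventually_ge_at_top[of N]
    proof eventually_elim
      case (elim n)
      have "(\<Sum>k<n. of_bool (B k \<omega>) :: real) = (\<Sum>k<N. of_bool (B k \<omega>)) + (\<Sum>k\<in>{N..<n}. of_bool (B k \<omega>))"
        unfolding lessThan_atLeast0 using elim by (intro sum.atLeastLessThan_concat[symmetric]) simp_all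
      then show ?case by (simp add: sum_subtractf add_divide_distrib diff_divide_distrib)
    qed
    ultimately show ?case unfolding mean by (simp add: tendsto_cong)
  qed
qed

end

section \<open>The speed for a fixed window length\<close>

lemma count_list_drop_eq_card:
  "count_list (drop m w) True = card {k \<in> {m..<length w}. w ! k}"
proof -
  have "count_list (drop m w) True = length (filter ((=) True) (drop m w))"
    by (rule count_list_eq_length_filter)
  also have "\<dots> = card {i. i < length w - m \<and> w ! (m + i)}"
    unfolding length_filter_conv_card by (rule arg_cong[of _ _ card]) auto
  also have "\<dots> = card ((+) m ` {i. i < length w - m \<and> w ! (m + i)})"
    by (rule card_image[symmetric]) simp
  also have "(+) m ` {i. i < length w - m \<and> w ! (m + i)} = {k \<in> {m..<length w}. w ! k}"
  proof -
    have "k \<in> (+) m ` {i. i < length w - m \<and> w ! (m + i)}" if "m \<le> k" "k < length w" "w ! k" for k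
      using that by (intro image_eqI[of _ _ "k - m"]) auto
    then show ?thesis by auto
  qed
  finally show ?thesis .
qed

section \<open>From positions of the walk to its jumps\<close>

context excited_walk
begin

definition right_jump :: "nat \<Rightarrow> 'a \<Rightarrow> bool" where
  "right_jump n \<omega> \<longleftrightarrow> X (Suc n) \<omega> = X n \<omega> + 1"

definition walk_path :: "bool list \<Rightarrow> nat \<Rightarrow> int" where
  "walk_path w k = x0 + (\<Sum>j<k. if w ! j then 1 else - 1)"

lemma walk_path_step: "walk_path w (Suc k) = walk_path w k + 1 \<longleftrightarrow> w ! k"
  by (simp add: walk_path_def)

lemma right_jump_measurable: "right_jump n \<in> measurable P (count_space UNIV)"
proof -
  note measurable_X [measurable]
  show ?thesis unfolding right_jump_def by measurable
qed

text \<open>\<open>excited_prob\<close> conditions on positions, while the chain is described by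
  jumps. With a fixed start and unit jumps the two descriptions of the past carry the same
  information.\<close>

lemma walk_path_iff_history:
  assumes "X 0 \<omega> = x0" and jumps: "\<forall>n. X (Suc n) \<omega> - X n \<omega> \<in> {1, -1}" and w: "length w = n"
  shows "history right_jump n \<omega> = w \<longleftrightarrow> (\<forall>k\<le>n. X k \<omega> = walk_path w k)"
proof
  assume "history right_jump n \<omega> = w"
  then have J: "\<forall>k<n. right_jump k \<omega> = w ! k"
    unfolding history_eq_iff[OF w] .
  have "k \<le> n \<Longrightarrow> X k \<omega> = walk_path w k" for k
  proof (induction k)
    case 0
    then show ?case using assms(1) by (simp add: walk_path_def)
  next
    case (Suc k)
    have "X (Suc k) \<omega> = X k \<omega> + (if w ! k then 1 else - 1)"
      using J[rule_format, of k] jumps[rule_format, of k] Suc.prems by (auto simp: right_jump_def)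
    then show ?case using Suc by (simp add: walk_path_def)
  qed
  then show "\<forall>k\<le>n. X k \<omega> = walk_path w k" by blast
next
  assume R: "\<forall>k\<le>n. X k \<omega> = walk_path w k"
  have "\<forall>k<n. right_jump k \<omega> = w ! k"
  proof (intro allI impI)
    fix k assume "k < n"
    then show "right_jump k \<omega> = w ! k"
      using R[rule_format, of k] R[rule_format, of "Suc k"] walk_path_step[of w k]
      by (simp add: right_jump_def)
  qed
  then show "history right_jump n \<omega> = w" unfolding history_eq_iff[OF w] .
qed

lemma right_jumps_walk_path:
  assumes "length w = n"
  shows "right_jumps N (walk_path w) n = count_list (drop (n - N) w) True"
  unfolding right_jumps_def walk_path_step count_list_drop_eq_card assms ..

lemma history_step:
  assumes "N \<le> n" and w: "length w = n" and i: "i \<le> l"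
    and "T i \<le> count_list (drop (n - N) w) True" and "count_list (drop (n - N) w) True < T (Suc i)"
  shows "prob {\<omega>\<in>space P. history right_jump n \<omega> = w \<and> right_jump n \<omega>}
    = p i * prob {\<omega>\<in>space P. history right_jump n \<omega> = w}"
proof -
  note measurable_X [measurable] right_jump_measurable [measurable]
  have H: "{\<omega>\<in>space P. history right_jump n \<omega> = w} \<in> sets P"
    unfolding history_eq_iff[OF w] by measurable
  have HJ: "{\<omega>\<in>space P. history right_jump n \<omega> = w \<and> right_jump n \<omega>} \<in> sets P"
    unfolding history_eq_iff[OF w] by measurable
  have Q: "{\<omega>\<in>space P. \<forall>k\<le>n. X k \<omega> = walk_path w k} \<in> sets P" by measurable
  have QJ: "{\<omega>\<in>space P. X (Suc n) \<omega> = X n \<omega> + 1 \<and> (\<forall>k\<le>n. X k \<omega> = walk_path w k)} \<in> sets P"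
    by measurable
  have eq: "AE \<omega> in P. history right_jump n \<omega> = w \<longleftrightarrow> (\<forall>k\<le>n. X k \<omega> = walk_path w k)"
    using start jump by eventually_elim (rule walk_path_iff_history[OF _ _ w])
  have 1: "prob {\<omega>\<in>space P. history right_jump n \<omega> = w} = prob {\<omega>\<in>space P. \<forall>k\<le>n. X k \<omega> = walk_path w k}"
    by (intro measure_eq_AE[OF _ H Q], use eq in eventually_elim) simp
  have 2: "prob {\<omega>\<in>space P. history right_jump n \<omega> = w \<and> right_jump n \<omega>}
      = prob {\<omega>\<in>space P. X (Suc n) \<omega> = X n \<omega> + 1 \<and> (\<forall>k\<le>n. X k \<omega> = walk_path w k)}"
    by (intro measure_eq_AE[OF _ HJ QJ], use eq in eventually_elim) (simp add: right_jump_def conj_commute)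
  show ?thesis
  proof (cases "prob {\<omega>\<in>space P. \<forall>k\<le>n. X k \<omega> = walk_path w k} > 0")
    case True
    have "\<P>(\<omega> in P. X (Suc n) \<omega> = X n \<omega> + 1 \<bar> \<forall>k\<le>n. X k \<omega> = walk_path w k) = p i"
      using assms right_jumps_walk_path[OF w] by (intro excited_prob True) simp_all
    then show ?thesis using True unfolding cond_prob_def 1 2 by (simp add: field_simps)
  next
    \<comment> \<open>Conditioning on a null path gives no information, but then both sides of the
      product form are 0.\<close>
    case False
    then have "prob {\<omega>\<in>space P. \<forall>k\<le>n. X k \<omega> = walk_path w k} = 0"
      by (simp only: zero_less_measure_iff not_not)
    moreover have "prob {\<omega>\<in>space P. X (Suc n) \<omega> = X n \<omega> + 1 \<and> (\<forall>k\<le>n. X k \<omega> = walk_path w k)}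
        \<le> prob {\<omega>\<in>space P. \<forall>k\<le>n. X k \<omega> = walk_path w k}"
      by (intro finite_measure_mono Q) auto
    ultimately show ?thesis unfolding 1 2
      using measure_nonneg[of P "{\<omega>\<in>space P. X (Suc n) \<omega> = X n \<omega> + 1 \<and> (\<forall>k\<le>n. X k \<omega> = walk_path w k)}"]
      by simp
  qed
qed

text \<open>Two candidate limits agree almost surely, hence agree, since a constant statement true
  almost surely in a probability space is true.\<close>

lemma speed_eqI:
  assumes "AE \<omega> in P. (\<lambda>n. real_of_int (X n \<omega>) / real n) \<longlonglongrightarrow> v"
  shows "speed P X = v"
  unfolding speed_def
proof (rule the_equality[of _ v])
  fix v' assume "AE \<omega> in P. (\<lambda>n. real_of_int (X n \<omega>) / real n) \<longlonglongrightarrow> v'"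
  with assms have "AE \<omega> in P. v' = v"
    by eventually_elim (rule LIMSEQ_unique)
  then show "v' = v" by simp
qed (fact assms)

lemma displacement_eq:
  assumes "\<forall>n. X (Suc n) \<omega> - X n \<omega> \<in> {1, -1}"
  shows "real_of_int (X n \<omega>) = real_of_int (X 0 \<omega>) + 2 * (\<Sum>k<n. of_bool (right_jump k \<omega>)) - real n"
proof (induction n)
  case (Suc n)
  have "X (Suc n) \<omega> = X n \<omega> + 2 * of_bool (right_jump n \<omega>) - 1"
    using assms[rule_format, of n] by (auto simp: right_jump_def)
  then show ?case using Suc by simp
qed simp

theorem speed_formula:
  assumes "jump_probabilities q e N"
    and stage: "\<And>i s. i \<le> l \<Longrightarrow> T i \<le> s \<Longrightarrow> s < T (Suc i) \<Longrightarrow> q s = p i"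
    and cover: "\<And>s. s \<le> N \<Longrightarrow> \<exists>i\<le>l. T i \<le> s \<and> s < T (Suc i)"
  shows "speed P X = 2 * ((\<Sum>s\<le>N. real (N choose s) * (stationary_weight q s * q s))
       / (\<Sum>s\<le>N. real (N choose s) * stationary_weight q s)) - 1"
proof (rule speed_eqI)
  interpret jump_probabilities q e N by fact
  interpret chain: recent_history_chain P q e N right_jump
  proof unfold_locales
    show "right_jump n \<in> measurable P (count_space UNIV)" for n
      by (rule right_jump_measurable)
    fix n w assume n: "N \<le> n" and w: "length (w :: bool list) = n"
    have "count_list (drop (n - N) w) True \<le> N"
      using count_le_length[of "drop (n - N) w" True] n w by simp
    then obtain i where "i \<le> l" "T i \<le> count_list (drop (n - N) w) True"
      "count_list (drop (n - N) w) True < T (Suc i)"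
      using cover by blast
    then show "prob {\<omega>\<in>space P. history right_jump n \<omega> = w \<and> right_jump n \<omega>}
        = q (count_list (drop (n - N) w) True) * prob {\<omega>\<in>space P. history right_jump n \<omega> = w}"
      using history_step[OF n w] stage by simp
  qed
  let ?c = "(\<Sum>s\<le>N. real (N choose s) * (stationary_weight q s * q s))
       / (\<Sum>s\<le>N. real (N choose s) * stationary_weight q s)"
  show "AE \<omega> in P. (\<lambda>n. real_of_int (X n \<omega>) / real n) \<longlonglongrightarrow> 2 * ?c - 1"
    using chain.jump_frequency jump
  proof eventually_elim
    case (elim \<omega>)
    have "(\<lambda>n. real_of_int (X 0 \<omega>) / real n + 2 * ((\<Sum>k<n. of_bool (right_jump k \<omega>)) / real n) - 1)
        \<longlonglongrightarrow> 0 + 2 * ?c - 1"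
      by (intro tendsto_diff tendsto_add tendsto_mult tendsto_const lim_const_over_n elim(1))
    moreover have "\<forall>\<^sub>F n in sequentially.
        real_of_int (X 0 \<omega>) / real n + 2 * ((\<Sum>k<n. of_bool (right_jump k \<omega>)) / real n) - 1
        = real_of_int (X n \<omega>) / real n"
      using eventually_gt_at_top[of 0]
    proof eventually_elim
      case (elim n)
      then show ?case
        unfolding displacement_eq[OF \<open>\<forall>n. X (Suc n) \<omega> - X n \<omega> \<in> {1, -1}\<close>, of n]
        by (simp add: diff_divide_distrib add_divide_distrib)
    qed
    ultimately show ?case by (simp add: tendsto_cong)
  qed
qed

end

section \<open>Decomposition of the stationary weight into stages\<close>

definition odds :: "real \<Rightarrow> real" where
  "odds x = x / (1 - x)"

lemma odds_pos: "0 < x \<Longrightarrow> x < 1 \<Longrightarrow> 0 < odds x"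
  by (simp add: odds_def)

text \<open>The numerator is the weight accumulated up to the threshold \<open>T i\<close>; the
  denominator is what completes a power of \<open>odds (p i)\<close> to a binomial
  probability.\<close>

definition stage_scale :: "(nat \<Rightarrow> real) \<Rightarrow> (nat \<Rightarrow> nat) \<Rightarrow> nat \<Rightarrow> nat \<Rightarrow> real" where
  "stage_scale p T N i =
     (\<Prod>k=1..i. odds (p (k - 1)) ^ (T k - T (k - 1))) / (odds (p i) ^ T i * (1 - p i) ^ N)"

definition stage_prob :: "(nat \<Rightarrow> real) \<Rightarrow> (nat \<Rightarrow> nat) \<Rightarrow> nat \<Rightarrow> nat \<Rightarrow> real" where
  "stage_prob p T N i = (\<Sum>s\<in>{T i..<T (Suc i)}. Bernstein N s (p i))"

definition stage_weight :: "(nat \<Rightarrow> real) \<Rightarrow> (nat \<Rightarrow> nat) \<Rightarrow> nat \<Rightarrow> nat \<Rightarrow> real" where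
  "stage_weight p T N i = stage_scale p T N i * stage_prob p T N i / (1 - p i)"

locale stages =
  fixes l N :: nat and T :: "nat \<Rightarrow> nat" and p :: "nat \<Rightarrow> real"
  assumes T_0: "T 0 = 0" and T_end: "T (Suc l) = Suc N"
    and T_less: "\<And>i. i \<le> l \<Longrightarrow> T i < T (Suc i)"
    and N_pos: "0 < N"
    and p_0: "0 < p 0" and p_mono: "\<And>i j. i \<le> j \<Longrightarrow> j \<le> l \<Longrightarrow> p i \<le> p j" and p_l: "p l < 1"
begin

lemma p_pos: "i \<le> l \<Longrightarrow> 0 < p i" and p_less_1: "i \<le> l \<Longrightarrow> p i < 1"
  using p_mono[of 0 i] p_mono[of i l] p_0 p_l by auto

lemma T_mono: "i \<le> j \<Longrightarrow> j \<le> Suc l \<Longrightarrow> T i \<le> T j"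
proof (induction j rule: dec_induct)
  case (step j)
  then show ?case using T_less[of j] by simp
qed simp

text \<open>The stage index is counted as the number of inner thresholds already reached. This makes
  the function total with values among \<open>p 0, ..., p l\<close>, so the uniform bounds hold
  everywhere.\<close>

definition jump_prob :: "nat \<Rightarrow> real" where
  "jump_prob s = p (card {i \<in> {1..l}. T i \<le> s})"

lemma jump_prob_eq:
  assumes "i \<le> l" "T i \<le> s" "s < T (Suc i)"
  shows "jump_prob s = p i"
proof -
  have "T j \<le> s \<longleftrightarrow> j \<le> i" if "j \<in> {1..l}" for j
    using T_mono[of j i] T_mono[of "Suc i" j] assms that by (cases "j \<le> i") auto
  then have "{j \<in> {1..l}. T j \<le> s} = {1..i}" using assms(1) by auto
  then show ?thesis by (simp add: jump_prob_def)
qed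

lemma jump_probabilities_jump_prob: "jump_probabilities jump_prob (min (p 0) (1 - p l)) N"
proof
  fix s
  define c where "c = card {i \<in> {1..l}. T i \<le> s}"
  have "c \<le> card {1..l}" unfolding c_def by (rule card_mono) auto
  moreover have "jump_prob s = p c" unfolding jump_prob_def c_def ..
  ultimately show "min (p 0) (1 - p l) \<le> jump_prob s" "jump_prob s \<le> 1 - min (p 0) (1 - p l)"
    using p_mono[of 0 c] p_mono[of c l] by (auto simp: min_def)
qed (use N_pos p_0 p_l in auto)

lemma stage_exists:
  assumes "s \<le> N"
  shows "\<exists>i\<le>l. T i \<le> s \<and> s < T (Suc i)"
proof -
  have "\<exists>i<m. T i \<le> s \<and> s < T (Suc i)" if "m \<le> Suc l" "s < T m" for m
    using that
  proof (induction m)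
    case (Suc m)
    then show ?case by (cases "s < T m") (auto simp: less_Suc_eq)
  qed (simp add: T_0)
  from this[of "Suc l"] show ?thesis using assms T_end by (auto simp: less_Suc_eq_le)
qed

text \<open>The product runs over \<open>u < s\<close>, so \<open>s = T (Suc i)\<close> is still
  allowed; this endpoint is what carries \<open>prod_odds_threshold\<close> from one stage to the
  next.\<close>

lemma prod_odds_within_stage:
  assumes "i \<le> l" and "T i \<le> s"
  shows "s \<le> T (Suc i) \<Longrightarrow> (\<Prod>u<s. odds (jump_prob u)) = (\<Prod>u<T i. odds (jump_prob u)) * odds (p i) ^ (s - T i)"
  using assms(2)
proof (induction s rule: dec_induct)
  case (step s)
  then have "jump_prob s = p i" using jump_prob_eq[of i s] assms(1) by simp
  then show ?case using step by (simp add: Suc_diff_le)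
qed simp

lemma prod_odds_threshold:
  "i \<le> Suc l \<Longrightarrow> (\<Prod>u<T i. odds (jump_prob u)) = (\<Prod>k=1..i. odds (p (k - 1)) ^ (T k - T (k - 1)))"
proof (induction i)
  case 0
  then show ?case by (simp add: T_0)
next
  case (Suc i)
  then show ?case using prod_odds_within_stage[of i "T (Suc i)"] T_less[of i] by simp
qed

text \<open>Within a stage the weight is geometric with ratio \<open>odds (p i)\<close>, and
  \<open>odds (p i) ^ s * (1 - p i) ^ N\<close> is the binomial term without its coefficient. The
  remaining \<open>1 / (1 - p i)\<close> comes from the denominator of
  \<open>stationary_weight\<close>.\<close>

lemma stationary_weight_in_stage:
  assumes i: "i \<le> l" and s: "s \<in> {T i..<T (Suc i)}"
  shows "real (N choose s) * stationary_weight jump_prob s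
    = stage_scale p T N i * Bernstein N s (p i) / (1 - p i)"
proof -
  have "s \<le> N" using s T_mono[of "Suc i" "Suc l"] T_end i by simp
  then have pN: "(1 - p i) ^ N = (1 - p i) ^ s * (1 - p i) ^ (N - s)"
    by (simp add: power_add[symmetric])
  have odds0: "odds (p i) > 0" using odds_pos p_pos p_less_1 i by simp
  have "stationary_weight jump_prob s
      = (\<Prod>k=1..i. odds (p (k - 1)) ^ (T k - T (k - 1))) * odds (p i) ^ (s - T i) / (1 - p i)"
    using prod_odds_within_stage[of i s] prod_odds_threshold[of i] jump_prob_eq[of i s] i s
    by (simp add: stationary_weight_def odds_def)
  also have "odds (p i) ^ (s - T i) = odds (p i) ^ s / odds (p i) ^ T i"
    using s odds0 by (simp add: power_diff)
  also have "odds (p i) ^ s = p i ^ s * (1 - p i) ^ (N - s) / (1 - p i) ^ N"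
    using p_less_1[OF i] by (simp add: pN odds_def power_divide)
  finally show ?thesis
    by (simp add: stage_scale_def Bernstein_def divide_inverse mult_ac)
qed

lemma sum_over_stages:
  fixes F :: "nat \<Rightarrow> real"
  shows "(\<Sum>s\<le>N. F s) = (\<Sum>i\<le>l. \<Sum>s\<in>{T i..<T (Suc i)}. F s)"
proof -
  have "(\<Sum>s<T m. F s) = (\<Sum>i<m. \<Sum>s\<in>{T i..<T (Suc i)}. F s)" if "m \<le> Suc l" for m
    using that
  proof (induction m)
    case (Suc m)
    have "(\<Sum>s<T (Suc m). F s) = (\<Sum>s<T m. F s) + (\<Sum>s\<in>{T m..<T (Suc m)}. F s)"
      unfolding lessThan_atLeast0 using T_less[of m] Suc.prems
      by (intro sum.atLeastLessThan_concat[symmetric]) simp_all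
    then show ?case using Suc by simp
  qed (simp add: T_0)
  from this[of "Suc l"] show ?thesis
    by (simp add: T_end lessThan_Suc_atMost)
qed

text \<open>The identity as \<open>h\<close> gives the numerator of the stationary jump frequency,
  the constant 1 its denominator.\<close>

lemma sum_stationary_weight:
  fixes h :: "real \<Rightarrow> real"
  shows "(\<Sum>s\<le>N. real (N choose s) * (stationary_weight jump_prob s * h (jump_prob s)))
    = (\<Sum>i\<le>l. h (p i) * stage_weight p T N i)"
  unfolding sum_over_stages
proof (rule sum.cong)
  fix i assume "i \<in> {..l}"
  then have i: "i \<le> l" by simp
  have "(\<Sum>s\<in>{T i..<T (Suc i)}. real (N choose s) * (stationary_weight jump_prob s * h (jump_prob s)))
      = (\<Sum>s\<in>{T i..<T (Suc i)}. h (p i) * stage_scale p T N i / (1 - p i) * Bernstein N s (p i))"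
  proof (rule sum.cong)
    fix s assume s: "s \<in> {T i..<T (Suc i)}"
    then have "jump_prob s = p i" using jump_prob_eq i by simp
    then show "real (N choose s) * (stationary_weight jump_prob s * h (jump_prob s))
        = h (p i) * stage_scale p T N i / (1 - p i) * Bernstein N s (p i)"
      using stationary_weight_in_stage[OF i s] by (simp add: mult.assoc[symmetric])
  qed simp
  also have "\<dots> = h (p i) * stage_scale p T N i / (1 - p i) * stage_prob p T N i"
    unfolding stage_prob_def by (rule sum_distrib_left[symmetric])
  finally show "(\<Sum>s\<in>{T i..<T (Suc i)}. real (N choose s) * (stationary_weight jump_prob s * h (jump_prob s)))
      = h (p i) * stage_weight p T N i"
    by (simp add: stage_weight_def)
qed simp

lemma stage_prob_bounds:
  assumes i: "i \<le> l"
  shows "0 \<le> stage_prob p T N i" "stage_prob p T N i \<le> 1"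
proof -
  have nonneg: "0 \<le> Bernstein N s (p i)" for s
    using p_pos[OF i] p_less_1[OF i] by (intro Bernstein_nonneg) auto
  then show "0 \<le> stage_prob p T N i" unfolding stage_prob_def by (intro sum_nonneg)
  have "{T i..<T (Suc i)} \<subseteq> {..N}" using T_mono[of "Suc i" "Suc l"] T_end i by auto
  then have "stage_prob p T N i \<le> (\<Sum>s\<le>N. Bernstein N s (p i))"
    unfolding stage_prob_def using nonneg by (intro sum_mono2) auto
  then show "stage_prob p T N i \<le> 1" by simp
qed

end

lemma (in excited_walk) speed_eq_stage_average:
  assumes "stages l N T p"
  shows "speed P X = 2 * ((\<Sum>i\<le>l. p i * stage_weight p T N i) / (\<Sum>i\<le>l. stage_weight p T N i)) - 1"
proof -
  interpret stages l N T p by fact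
  show ?thesis
    using speed_formula[OF jump_probabilities_jump_prob jump_prob_eq stage_exists]
      sum_stationary_weight[of "\<lambda>x. x"] sum_stationary_weight[of "\<lambda>x. 1"] by simp
qed

section \<open>Asymptotics of the stage weights\<close>

text \<open>Each exponent \<open>M N k - M N (k - 1)\<close> splits into
  \<open>N * (r k - r (k - 1))\<close>, collected in \<open>K ^ N\<close>, and a deviation,
  collected in \<open>alpha_seq\<close>. The denominator of \<open>K\<close> is first rewritten as
  \<open>odds (p i) powr r i * (1 - p i)\<close>.\<close>

lemma stage_scale_conv_K:
  assumes p: "\<And>k. k \<le> i \<Longrightarrow> 0 < p k" "\<And>k. k \<le> i \<Longrightarrow> p k < 1"
    and mono: "\<And>k. k \<in> {1..i} \<Longrightarrow> M N (k - 1) \<le> M N k"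
  shows "stage_scale p (M N) N i = K p r i ^ N * alpha_seq p r M i N"
proof -
  have odds0: "0 < odds (p k)" if "k \<le> i" for k using odds_pos p that by simp
  let ?P = "\<Prod>k=1..i. odds (p (k - 1)) powr (r k - r (k - 1))"
  let ?P' = "\<Prod>k=1..i. odds (p (k - 1)) powr
        ((real (M N k) - real N * r k) - (real (M N (k - 1)) - real N * r (k - 1)))"
  have K_eq: "K p r i = ?P / (odds (p i) powr r i * (1 - p i))"
    using p[of i] by (simp add: K_def odds_def powr_divide powr_diff)
  have powr_N: "(odds (p k) powr a) ^ N = odds (p k) powr (real N * a)" if "k \<le> i" for k a
    using odds0[OF that] by (simp add: powr_power)
  have A: "?P ^ N * ?P' = (\<Prod>k=1..i. odds (p (k - 1)) ^ (M N k - M N (k - 1)))"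
    unfolding prod_power_distrib prod.distrib[symmetric]
  proof (rule prod.cong)
    fix k assume k: "k \<in> {1..i}"
    then have "(odds (p (k - 1)) powr (r k - r (k - 1))) ^ N * odds (p (k - 1)) powr
        ((real (M N k) - real N * r k) - (real (M N (k - 1)) - real N * r (k - 1)))
        = odds (p (k - 1)) powr (real (M N k - M N (k - 1)))"
      using mono[OF k] by (subst powr_N) (auto simp: powr_add[symmetric] of_nat_diff algebra_simps)
    also have "\<dots> = odds (p (k - 1)) ^ (M N k - M N (k - 1))"
      using k by (intro powr_realpow odds0) auto
    finally show "(odds (p (k - 1)) powr (r k - r (k - 1))) ^ N * odds (p (k - 1)) powr
        ((real (M N k) - real N * r k) - (real (M N (k - 1)) - real N * r (k - 1)))
        = odds (p (k - 1)) ^ (M N k - M N (k - 1))" .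
  qed simp
  have O: "odds (p i) powr (- real (M N i) + real N * r i)
      = (odds (p i) powr r i) ^ N / odds (p i) ^ M N i"
    using odds0[of i] by (simp add: powr_N powr_diff powr_realpow)
  have al: "alpha_seq p r M i N = odds (p i) powr (- real (M N i) + real N * r i) * ?P'"
    by (simp add: alpha_seq_def odds_def)
  have "K p r i ^ N * alpha_seq p r M i N = (?P ^ N * ?P') * odds (p i) powr (- real (M N i) + real N * r i)
      / ((odds (p i) powr r i) ^ N * (1 - p i) ^ N)"
    by (simp add: K_eq al power_divide power_mult_distrib)
  also have "\<dots> = (\<Prod>k=1..i. odds (p (k - 1)) ^ (M N k - M N (k - 1))) / (odds (p i) ^ M N i * (1 - p i) ^ N)"
    unfolding A O using odds0[of i] by simp
  finally show ?thesis by (simp add: stage_scale_def)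
qed

text \<open>The \<open>N\<close>-th root of \<open>alpha_seq\<close>: all exponents are divided by
  \<open>N\<close>, so they tend to 0. That its limit is 1 is the sense in which
  \<open>alpha_seq\<close> is subexponential.\<close>

definition alpha_root ::
  "(nat \<Rightarrow> real) \<Rightarrow> (nat \<Rightarrow> real) \<Rightarrow> (nat \<Rightarrow> nat \<Rightarrow> nat) \<Rightarrow> nat \<Rightarrow> nat \<Rightarrow> real" where
  "alpha_root p r M i N =
     odds (p i) powr (r i - real (M N i) / real N) *
     (\<Prod>k=1..i. odds (p (k - 1)) powr
        ((real (M N k) / real N - r k) - (real (M N (k - 1)) / real N - r (k - 1))))"

lemma alpha_root_pos:
  assumes "\<And>k. k \<le> i \<Longrightarrow> 0 < p k" "\<And>k. k \<le> i \<Longrightarrow> p k < 1"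
  shows "0 < alpha_root p r M i N"
  unfolding alpha_root_def using odds_pos assms
  by (intro mult_pos_pos prod_pos ballI) (auto simp: powr_gt_zero less_imp_neq[symmetric])

lemma alpha_seq_conv_root:
  assumes "\<And>k. k \<le> i \<Longrightarrow> 0 < p k" "\<And>k. k \<le> i \<Longrightarrow> p k < 1" and "0 < N"
  shows "alpha_seq p r M i N = alpha_root p r M i N ^ N"
proof -
  have *: "(odds (p k) powr a) ^ N = odds (p k) powr (real N * a)" if "k \<le> i" for k a
    using odds_pos[of "p k"] assms that by (simp add: powr_power)
  have "(\<Prod>k=1..i. odds (p (k - 1)) powr
        ((real (M N k) / real N - r k) - (real (M N (k - 1)) / real N - r (k - 1)))) ^ N
      = (\<Prod>k=1..i. odds (p (k - 1)) powr
        ((real (M N k) - real N * r k) - (real (M N (k - 1)) - real N * r (k - 1))))"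
    unfolding prod_power_distrib
    using assms(3) by (intro prod.cong refl, subst *) (auto simp: right_diff_distrib)
  moreover have "(odds (p i) powr (r i - real (M N i) / real N)) ^ N
      = odds (p i) powr (- real (M N i) + real N * r i)"
    using assms(3) by (subst *) (auto simp: right_diff_distrib)
  ultimately show ?thesis
    by (simp add: alpha_seq_def alpha_root_def power_mult_distrib odds_def)
qed

lemma alpha_root_tendsto:
  assumes "\<And>k. k \<le> i \<Longrightarrow> 0 < p k" "\<And>k. k \<le> i \<Longrightarrow> p k < 1"
    and lim: "\<And>k. k \<le> i \<Longrightarrow> (\<lambda>N. real (M N k) / real N) \<longlonglongrightarrow> r k"
  shows "alpha_root p r M i \<longlonglongrightarrow> 1"
proof -
  have odds0: "odds (p k) \<noteq> 0" if "k \<le> i" for k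
    using odds_pos[of "p k"] assms(1,2) that by fastforce
  have "(\<lambda>N. odds (p i) powr (r i - real (M N i) / real N) *
     (\<Prod>k=1..i. odds (p (k - 1)) powr
        ((real (M N k) / real N - r k) - (real (M N (k - 1)) / real N - r (k - 1)))))
    \<longlonglongrightarrow> odds (p i) powr (r i - r i) *
     (\<Prod>k=1..i. odds (p (k - 1)) powr ((r k - r k) - (r (k - 1) - r (k - 1))))"
    by (intro tendsto_mult tendsto_prod tendsto_powr tendsto_diff tendsto_const lim odds0) auto
  moreover have "(\<Prod>k=1..i. odds (p (k - 1)) powr ((r k - r k) - (r (k - 1) - r (k - 1)))) = 1"
    using odds0 by (intro prod.neutral) auto
  ultimately show ?thesis using odds0[of i] unfolding alpha_root_def[abs_def] by simp
qed

text \<open>Used with ratios of \<open>K\<close> multiplied by \<open>alpha_root\<close> factors: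
  the base varies with the exponent but eventually stays below a fixed \<open>y < 1\<close>.\<close>

lemma power_index_tendsto_0:
  fixes x :: "nat \<Rightarrow> real"
  assumes "x \<longlonglongrightarrow> c" and "c < 1" and "\<And>n. 0 \<le> x n"
  shows "(\<lambda>n. x n ^ n) \<longlonglongrightarrow> 0"
proof -
  have "0 \<le> c" using assms(1,3) by (intro LIMSEQ_le_const) auto
  define y where "y = (c + 1) / 2"
  have y: "c < y" "0 \<le> y" "y < 1" using assms(2) \<open>0 \<le> c\<close> by (auto simp: y_def)
  have ev: "\<forall>\<^sub>F n in sequentially. x n < y"
    using assms(1) y(1) by (rule order_tendstoD)
  show ?thesis
  proof (rule Lim_null_comparison)
    show "(\<lambda>n. y ^ n) \<longlonglongrightarrow> 0" using y by (intro LIMSEQ_power_zero) auto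
    show "\<forall>\<^sub>F n in sequentially. norm (x n ^ n) \<le> y ^ n"
      using ev by eventually_elim (simp add: assms(3) power_mono)
  qed
qed

text \<open>
  Equal to \<open>x powr t * (1 - x) powr (1 - t)\<close>, which is unimodal in \<open>x\<close> with its maximum at
  \<open>x = t\<close>. Passing from stage \<open>j\<close> to the next one multiplies \<open>K\<close> by a ratio of two such factors
  (\<open>K_Suc\<close>), which orders the values of \<open>K\<close>.
\<close>

definition bernoulli_factor :: "real \<Rightarrow> real \<Rightarrow> real" where
  "bernoulli_factor t x = odds x powr t * (1 - x)"

lemma ln_bernoulli_factor:
  assumes "0 < x" "x < 1"
  shows "ln (bernoulli_factor t x) = t * ln x + (1 - t) * ln (1 - x)"
proof -
  have "ln (bernoulli_factor t x) = t * ln (odds x) + ln (1 - x)"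
    unfolding bernoulli_factor_def using assms odds_pos[of x] by (subst ln_mult) auto
  also have "ln (odds x) = ln x - ln (1 - x)" using assms by (simp add: odds_def ln_div)
  finally show ?thesis by (simp add: algebra_simps)
qed

lemma bernoulli_factor_pos: "0 < x \<Longrightarrow> x < 1 \<Longrightarrow> 0 < bernoulli_factor t x"
  using odds_pos[of x] by (simp add: bernoulli_factor_def)

lemma ln_strict: "0 < x \<Longrightarrow> x \<noteq> 1 \<Longrightarrow> ln x < x - (1 :: real)"
  using ln_le_minus_one[of x] ln_eq_minus_one[of x] by fastforce

text \<open>Apply \<open>ln x < x - 1\<close> to the ratios \<open>a / b\<close> and
  \<open>(1 - a) / (1 - b)\<close>. Strictness survives through the first, whose weight
  \<open>t\<close> is positive; the weight \<open>1 - t\<close> may be 0. The resulting bound has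
  the sign of \<open>(1 - t) / (1 - b) - t / b\<close>, which is at most 0 because
  \<open>b \<le> t\<close>.\<close>

lemma bernoulli_factor_strict_mono:
  assumes "0 < a" "a < b" "b < 1" "b \<le> t" "t \<le> 1"
  shows "bernoulli_factor t a < bernoulli_factor t b"
proof -
  have "ln (a / b) < a / b - 1" using assms by (intro ln_strict) auto
  moreover have "ln ((1 - a) / (1 - b)) < (1 - a) / (1 - b) - 1" using assms by (intro ln_strict) auto
  ultimately have "t * (ln a - ln b) + (1 - t) * (ln (1 - a) - ln (1 - b))
      < t * (a / b - 1) + (1 - t) * ((1 - a) / (1 - b) - 1)"
    using assms by (intro add_less_le_mono mult_strict_left_mono mult_left_mono) (auto simp: ln_div)
  also have "\<dots> = (b - a) * ((1 - t) / (1 - b) - t / b)"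
    using assms by (simp add: field_simps)
  also have "\<dots> \<le> 0"
  proof -
    have "(1 - t) / (1 - b) \<le> 1" "1 \<le> t / b" using assms by (auto simp: divide_le_eq le_divide_eq)
    then have "(1 - t) / (1 - b) - t / b \<le> 0" by linarith
    with assms show ?thesis by (intro mult_nonneg_nonpos) simp_all
  qed
  finally have "ln (bernoulli_factor t a) < ln (bernoulli_factor t b)"
    using assms by (simp add: ln_bernoulli_factor algebra_simps)
  then show ?thesis using assms bernoulli_factor_pos by simp
qed

text \<open>Exchanging successes and failures carries the increasing branch, left of
  \<open>t\<close>, to the decreasing one on its right.\<close>

lemma bernoulli_factor_reflect:
  assumes "0 < x" "x < 1"
  shows "bernoulli_factor (1 - t) (1 - x) = bernoulli_factor t x"
proof -
  have "ln (bernoulli_factor (1 - t) (1 - x)) = ln (bernoulli_factor t x)"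
    using assms ln_bernoulli_factor[of x t] ln_bernoulli_factor[of "1 - x" "1 - t"] by simp
  then show ?thesis using assms bernoulli_factor_pos[of x t] bernoulli_factor_pos[of "1 - x" "1 - t"] by simp
qed

lemma bernoulli_factor_strict_antimono:
  assumes "0 < a" "a < b" "b < 1" "t \<le> a" "0 \<le> t"
  shows "bernoulli_factor t b < bernoulli_factor t a"
  using bernoulli_factor_strict_mono[of "1 - b" "1 - a" "1 - t"] bernoulli_factor_reflect[of a t]
    bernoulli_factor_reflect[of b t] assms by simp

lemma K_pos:
  assumes "\<And>k. k \<le> i \<Longrightarrow> 0 < p k" "\<And>k. k \<le> i \<Longrightarrow> p k < 1"
  shows "0 < K p r i"
proof -
  have "p (k - 1) / (1 - p (k - 1)) \<noteq> 0" if "k \<in> {1..i}" for k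
    using assms(1)[of "k - 1"] assms(2)[of "k - 1"] that by (cases k) auto
  then show ?thesis
    unfolding K_def using assms[of i] by (intro mult_pos_pos prod_pos divide_pos_pos) auto
qed

text \<open>The factor of the product that is new at \<open>Suc j\<close> changes the exponent
  \<open>r j\<close> belonging to \<open>p j\<close> into \<open>r (Suc j)\<close>, so both
  denominators are taken at the same \<open>r (Suc j)\<close>.\<close>

lemma K_Suc:
  assumes "0 < p j" "p j < 1" "0 < p (Suc j)" "p (Suc j) < 1"
  shows "K p r (Suc j) * bernoulli_factor (r (Suc j)) (p (Suc j))
    = K p r j * bernoulli_factor (r (Suc j)) (p j)"
proof -
  have K_eq: "K p r i = (\<Prod>k=1..i. odds (p (k - 1)) powr (r k - r (k - 1))) / (odds (p i) powr r i * (1 - p i))"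
    if "0 < p i" "p i < 1" for i
    using that by (simp add: K_def odds_def powr_divide powr_diff)
  have "odds (p j) > 0" "odds (p (Suc j)) > 0" using odds_pos assms by auto
  then show ?thesis
    using assms by (simp add: K_eq bernoulli_factor_def powr_diff)
qed

text \<open>Chebyshev's inequality for the binomial distribution. The square is expanded in
  \<open>k * (k - 1)\<close>, \<open>k\<close> and 1, for which the Bernstein sums are known; the
  variance is at most \<open>n\<close>.\<close>

lemma Bernstein_tail:
  assumes x: "0 \<le> x" "x \<le> 1" and "0 < \<delta>" "0 < n" and A: "A \<subseteq> {..n}"
    and far: "\<And>k. k \<in> A \<Longrightarrow> \<delta> * real n \<le> \<bar>real k - real n * x\<bar>"
  shows "(\<Sum>k\<in>A. Bernstein n k x) \<le> 1 / (real n * \<delta>\<^sup>2)"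
proof -
  have "(\<Sum>k\<le>n. (real k - real n * x)\<^sup>2 * Bernstein n k x)
      = (\<Sum>k\<le>n. real k * (real k - 1) * Bernstein n k x) + (1 - 2 * real n * x) * (\<Sum>k\<le>n. real k * Bernstein n k x)
        + (real n * x)\<^sup>2 * (\<Sum>k\<le>n. Bernstein n k x)"
    unfolding sum_distrib_left sum.distrib[symmetric]
    by (intro sum.cong) (auto simp: power2_eq_square algebra_simps)
  also have "\<dots> = real n * (x * (1 - x))"
    unfolding sum_kk_Bernstein sum_k_Bernstein sum_Bernstein
    by (simp add: power2_eq_square algebra_simps)
  also have "\<dots> \<le> real n * 1"
    using x by (intro mult_left_mono) (auto intro: mult_le_one)
  finally have var: "(\<Sum>k\<le>n. (real k - real n * x)\<^sup>2 * Bernstein n k x) \<le> real n" by simp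
  have B: "0 \<le> Bernstein n k x" for k using x by (rule Bernstein_nonneg)
  have "(\<delta> * real n)\<^sup>2 * (\<Sum>k\<in>A. Bernstein n k x) = (\<Sum>k\<in>A. (\<delta> * real n)\<^sup>2 * Bernstein n k x)"
    by (rule sum_distrib_left)
  also have "\<dots> \<le> (\<Sum>k\<in>A. (real k - real n * x)\<^sup>2 * Bernstein n k x)"
  proof (intro sum_mono mult_right_mono B)
    fix k assume "k \<in> A"
    then show "(\<delta> * real n)\<^sup>2 \<le> (real k - real n * x)\<^sup>2"
      using far[of k] assms(3,4) by (simp add: abs_le_square_iff[symmetric])
  qed
  also have "\<dots> \<le> (\<Sum>k\<le>n. (real k - real n * x)\<^sup>2 * Bernstein n k x)"
    using A B by (intro sum_mono2) auto
  also note var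
  finally show ?thesis
    using assms(3,4) by (simp add: field_simps power2_eq_square)
qed

lemma Bernstein_window_tendsto_1:
  assumes x: "0 < x" "x < 1"
    and a: "(\<lambda>n. real (a n) / real n) \<longlonglongrightarrow> s" and b: "(\<lambda>n. real (b n) / real n) \<longlonglongrightarrow> t"
    and "s < x" "x < t" and b_le: "\<forall>\<^sub>F n in sequentially. b n \<le> Suc n"
  shows "(\<lambda>n. \<Sum>k\<in>{a n..<b n}. Bernstein n k x) \<longlonglongrightarrow> 1"
proof -
  \<comment> \<open>Half the smaller gap: the other half absorbs the error in \<open>a n / n\<close>
    and \<open>b n / n\<close>, which only approach \<open>s\<close> and \<open>t\<close>.\<close>
  define \<delta> where "\<delta> = min (x - s) (t - x) / 2"
  have \<delta>: "0 < \<delta>" "s < x - \<delta>" "x + \<delta> < t" using assms by (auto simp: \<delta>_def min_def field_simps)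
  have ea: "\<forall>\<^sub>F n in sequentially. real (a n) / real n < x - \<delta>"
    using a \<delta>(2) by (rule order_tendstoD)
  have eb: "\<forall>\<^sub>F n in sequentially. x + \<delta> < real (b n) / real n"
    using b \<delta>(3) by (rule order_tendstoD)
  have ev: "\<forall>\<^sub>F n in sequentially. 1 - 1 / (real n * \<delta>\<^sup>2) \<le> (\<Sum>k\<in>{a n..<b n}. Bernstein n k x)
      \<and> (\<Sum>k\<in>{a n..<b n}. Bernstein n k x) \<le> 1"
    using ea eb b_le eventually_gt_at_top[of 0]
  proof eventually_elim
    case (elim n)
    let ?A = "{a n..<b n}"
    have sub: "?A \<subseteq> {..n}" using elim(3) by auto
    have "\<delta> * real n \<le> \<bar>real k - real n * x\<bar>" if "k \<in> {..n} - ?A" for k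
    proof -
      have "real (a n) < (x - \<delta>) * real n" "(x + \<delta>) * real n < real (b n)"
        using elim by (simp_all add: field_simps)
      moreover have "real k < real (a n) \<or> real (b n) \<le> real k" using that by auto
      ultimately show ?thesis by (auto simp: algebra_simps)
    qed
    then have "(\<Sum>k\<in>{..n} - ?A. Bernstein n k x) \<le> 1 / (real n * \<delta>\<^sup>2)"
      using x \<delta>(1) elim(4) by (intro Bernstein_tail) auto
    moreover have "(\<Sum>k\<in>{..n} - ?A. Bernstein n k x) + (\<Sum>k\<in>?A. Bernstein n k x) = 1"
      using sum.subset_diff[OF sub, of "\<lambda>k. Bernstein n k x"] by simp
    moreover have "0 \<le> (\<Sum>k\<in>{..n} - ?A. Bernstein n k x)"
      using x by (intro sum_nonneg Bernstein_nonneg) auto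
    ultimately show ?case by linarith
  qed
  have "(\<lambda>n. 1 - inverse (\<delta>\<^sup>2) / real n) \<longlonglongrightarrow> 1 - 0"
    by (intro tendsto_diff tendsto_const lim_const_over_n)
  then have lim: "(\<lambda>n. 1 - 1 / (real n * \<delta>\<^sup>2)) \<longlonglongrightarrow> 1"
    by (simp add: divide_inverse mult.commute)
  show ?thesis
    by (rule tendsto_sandwich[OF _ _ lim tendsto_const]) (use ev in \<open>auto elim: eventually_mono\<close>)
qed

section \<open>Comparison of the stages through \<open>K\<close>\<close>

locale threshold_family =
  fixes l :: nat and p r :: "nat \<Rightarrow> real" and M :: "nat \<Rightarrow> nat \<Rightarrow> nat"
  assumes p_0: "0 < p 0" and p_l: "p l < 1" and p_strict: "\<And>i j. i < j \<Longrightarrow> j \<le> l \<Longrightarrow> p i < p j"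
    and r_0: "r 0 = 0" and r_end: "r (Suc l) = 1"
    and stages: "\<And>N. l \<le> N \<Longrightarrow> 0 < N \<Longrightarrow> stages l N (M N) p"
    and M_lim: "\<And>i. i \<le> Suc l \<Longrightarrow> (\<lambda>N. real (M N i) / real N) \<longlonglongrightarrow> r i"
begin

lemma p_pos: "i \<le> l \<Longrightarrow> 0 < p i"
  using p_strict[of 0 i] p_0 by (cases "i = 0") auto

lemma p_less_1: "i \<le> l \<Longrightarrow> p i < 1"
  using p_strict[of i l] p_l by (cases "i = l") auto

lemma r_bounds:
  assumes "i \<le> Suc l"
  shows "0 \<le> r i" "r i \<le> 1"
proof -
  show "0 \<le> r i" using M_lim[OF assms] by (rule LIMSEQ_le_const) auto
  have "r i \<le> r (Suc l)"
  proof (rule LIMSEQ_le[OF M_lim M_lim])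
    have "real (M n i) / real n \<le> real (M n (Suc l)) / real n" if "Suc l \<le> n" for n
      using that stages.T_mono[OF stages, of n i "Suc l"] assms by (intro divide_right_mono) auto
    then show "\<exists>N. \<forall>n\<ge>N. real (M n i) / real n \<le> real (M n (Suc l)) / real n" by blast
  qed (use assms in auto)
  then show "r i \<le> 1" by (simp add: r_end)
qed

abbreviation admissible :: "nat \<Rightarrow> bool" where
  "admissible i \<equiv> r i < p i \<and> p i < r (Suc i)"

lemma K_pos': "i \<le> l \<Longrightarrow> 0 < K p r i"
  using p_pos p_less_1 by (intro K_pos) auto

text \<open>Here \<open>p j\<close> and \<open>p (Suc j)\<close> both lie on the decreasing branch
  of \<open>bernoulli_factor (r (Suc j))\<close>. The factor drops from \<open>j\<close> to
  \<open>Suc j\<close>, so \<open>K\<close> must rise by \<open>K_Suc\<close>.\<close>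

lemma K_less_Suc:
  assumes "j < l" "r (Suc j) \<le> p j"
  shows "K p r j < K p r (Suc j)"
proof -
  let ?\<phi> = "bernoulli_factor (r (Suc j))"
  have "?\<phi> (p (Suc j)) < ?\<phi> (p j)"
    using assms p_pos[of j] p_less_1[of "Suc j"] p_strict[of j "Suc j"] r_bounds[of "Suc j"]
    by (intro bernoulli_factor_strict_antimono) auto
  then have "K p r j * ?\<phi> (p (Suc j)) < K p r j * ?\<phi> (p j)"
    using K_pos'[of j] assms by simp
  also have "\<dots> = K p r (Suc j) * ?\<phi> (p (Suc j))"
    using K_Suc[of p j r] p_pos[of j] p_less_1[of j] p_pos[of "Suc j"] p_less_1[of "Suc j"] assms by simp
  finally show ?thesis
    using bernoulli_factor_pos[of "p (Suc j)"] p_pos[of "Suc j"] p_less_1[of "Suc j"] assms by simp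
qed

lemma K_Suc_less:
  assumes "j < l" "p (Suc j) \<le> r (Suc j)"
  shows "K p r (Suc j) < K p r j"
proof -
  let ?\<phi> = "bernoulli_factor (r (Suc j))"
  have "?\<phi> (p j) < ?\<phi> (p (Suc j))"
    using assms p_pos[of j] p_less_1[of "Suc j"] p_strict[of j "Suc j"] r_bounds[of "Suc j"]
    by (intro bernoulli_factor_strict_mono) auto
  then have "K p r j * ?\<phi> (p j) < K p r j * ?\<phi> (p (Suc j))"
    using K_pos'[of j] assms by simp
  moreover have "K p r j * ?\<phi> (p j) = K p r (Suc j) * ?\<phi> (p (Suc j))"
    using K_Suc[of p j r] p_pos[of j] p_less_1[of j] p_pos[of "Suc j"] p_less_1[of "Suc j"] assms by simp
  ultimately show ?thesis
    using bernoulli_factor_pos[of "p (Suc j)"] p_pos[of "Suc j"] p_less_1[of "Suc j"] assms by simp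
qed

text \<open>Climb while the right inequality fails. Then
  \<open>r (Suc j) \<le> p j < p (Suc j)\<close> preserves the left inequality, \<open>K\<close>
  increases, and the climb ends at \<open>l\<close> at the latest because
  \<open>p l < 1 = r (Suc l)\<close>. In \<open>admissible_below\<close> the descent ends at 0
  because \<open>r 0 = 0 < p 0\<close>.\<close>

lemma admissible_above:
  "j \<le> l \<Longrightarrow> r j < p j \<Longrightarrow> \<exists>i\<le>l. admissible i \<and> K p r j \<le> K p r i"
proof (induction "l - j" arbitrary: j rule: less_induct)
  case less
  show ?case
  proof (cases "p j < r (Suc j)")
    case False
    then have "j < l" using less.prems p_l r_end by (cases "j = l") auto
    then have "K p r j < K p r (Suc j)" "r (Suc j) < p (Suc j)"
      using K_less_Suc[of j] p_strict[of j "Suc j"] False by auto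
    then show ?thesis using less.hyps[of "Suc j"] \<open>j < l\<close> by force
  qed (use less.prems in auto)
qed

lemma admissible_below:
  "j \<le> l \<Longrightarrow> p j < r (Suc j) \<Longrightarrow> \<exists>i\<le>l. admissible i \<and> K p r j \<le> K p r i"
proof (induction j)
  case 0
  then show ?case using p_0 r_0 by auto
next
  case (Suc j)
  show ?case
  proof (cases "r (Suc j) < p (Suc j)")
    case False
    then have "K p r (Suc j) < K p r j" "p j < r (Suc j)"
      using K_Suc_less[of j] p_strict[of j "Suc j"] Suc.prems by auto
    then show ?thesis using Suc.IH Suc.prems by force
  qed (use Suc.prems in auto)
qed

text \<open>One move, down if the left inequality fails and up otherwise, is already strict and
  produces the one-sided inequality from which the descent or climb can continue.\<close>

lemma inadmissible_dominated:
  assumes "j \<le> l" "\<not> admissible j"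
  shows "\<exists>i\<le>l. admissible i \<and> K p r j < K p r i"
proof (cases "p j \<le> r j")
  case True
  then obtain k where k: "j = Suc k" using p_0 r_0 by (cases j) auto
  then have "K p r j < K p r k" "p k < r (Suc k)"
    using K_Suc_less[of k] p_strict[of k "Suc k"] True assms by auto
  then show ?thesis using admissible_below[of k] assms k by force
next
  case False
  then have *: "r (Suc j) \<le> p j" using assms by auto
  then have "j < l" using assms p_l r_end by (cases "j = l") auto
  then have "K p r j < K p r (Suc j)" "r (Suc j) < p (Suc j)"
    using K_less_Suc[of j] p_strict[of j "Suc j"] * by auto
  then show ?thesis using admissible_above[of "Suc j"] \<open>j < l\<close> by force
qed

lemma dominantD:
  assumes "i \<in> dominant l p r"
  shows "i \<le> l" "admissible i"
  using assms by (auto simp: dominant_def argmax_def)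

lemma finite_dominant [simp]: "finite (dominant l p r)"
  by (rule finite_subset[of _ "{..l}"]) (use dominantD in auto)

lemma K_le_dominant:
  assumes "i \<in> dominant l p r" "j \<le> l" "admissible j"
  shows "K p r j \<le> K p r i"
  using assms by (auto simp: dominant_def argmax_def)

lemma K_dominant_eq: "i \<in> dominant l p r \<Longrightarrow> j \<in> dominant l p r \<Longrightarrow> K p r i = K p r j"
  by (simp add: dominant_def argmax_def)

text \<open>\<open>dominant\<close> maximises only over admissible stages; here the maximum becomes
  strict against every other stage.\<close>

lemma K_less_dominant:
  assumes i: "i \<in> dominant l p r" and j: "j \<le> l" "j \<notin> dominant l p r"
  shows "K p r j < K p r i"
proof (cases "admissible j")
  case True
  then have "K p r j \<noteq> K p r i" using i j by (auto simp: dominant_def argmax_def)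
  then show ?thesis using K_le_dominant[OF i j(1) True] by simp
next
  case False
  then show ?thesis using inadmissible_dominated[OF j(1)] K_le_dominant[OF i] by force
qed

lemma alpha_seq_pos: "i \<le> l \<Longrightarrow> 0 < alpha_seq p r M i N"
proof -
  assume i: "i \<le> l"
  have "p k / (1 - p k) \<noteq> 0" if "k \<le> i" for k
    using p_pos[of k] p_less_1[of k] that i by auto
  then show ?thesis unfolding alpha_seq_def by (intro mult_pos_pos prod_pos) auto
qed

lemma alpha_root: "i \<le> l \<Longrightarrow> 0 < N \<Longrightarrow> alpha_seq p r M i N = alpha_root p r M i N ^ N"
  using p_pos p_less_1 by (intro alpha_seq_conv_root) auto

lemma alpha_root_lim: "i \<le> l \<Longrightarrow> alpha_root p r M i \<longlonglongrightarrow> 1"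
  using p_pos p_less_1 M_lim by (intro alpha_root_tendsto) auto

lemma alpha_root_pos': "i \<le> l \<Longrightarrow> 0 < alpha_root p r M i N"
  using p_pos p_less_1 by (intro alpha_root_pos) auto

text \<open>Two normalisations: by \<open>K ^ N\<close> for finite limits of
  \<open>alpha_seq\<close>, and by the whole scale of stage \<open>i\<close> when that stage
  prevails alone.\<close>

lemma dominated_scale_tendsto_0:
  assumes i: "i \<in> dominant l p r" and j: "j \<le> l" "j \<notin> dominant l p r"
  shows "(\<lambda>N. K p r j ^ N * alpha_seq p r M j N / K p r i ^ N) \<longlonglongrightarrow> 0"
    and "(\<lambda>N. K p r j ^ N * alpha_seq p r M j N / (K p r i ^ N * alpha_seq p r M i N)) \<longlonglongrightarrow> 0"
proof -
  have il: "i \<le> l" using dominantD[OF i] by simp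
  have less: "K p r j / K p r i < 1" using K_less_dominant[OF i j] K_pos'[OF il] by simp
  have "(\<lambda>N. K p r j * alpha_root p r M j N / K p r i) \<longlonglongrightarrow> K p r j * 1 / K p r i"
    using K_pos'[OF il] by (intro tendsto_divide tendsto_mult tendsto_const alpha_root_lim j) auto
  then have 1: "(\<lambda>N. (K p r j * alpha_root p r M j N / K p r i) ^ N) \<longlonglongrightarrow> 0"
    using less K_pos'[OF il] K_pos'[OF j(1)] alpha_root_pos'[OF j(1)]
    by (intro power_index_tendsto_0) (auto intro!: divide_nonneg_nonneg mult_nonneg_nonneg less_imp_le)
  show "(\<lambda>N. K p r j ^ N * alpha_seq p r M j N / K p r i ^ N) \<longlonglongrightarrow> 0"
    by (rule Lim_transform_eventually[OF 1])
       (use eventually_gt_at_top[of 0] in eventually_elim,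
        simp add: alpha_root[OF j(1)] power_divide power_mult_distrib)
  have "(\<lambda>N. K p r j * alpha_root p r M j N / (K p r i * alpha_root p r M i N))
      \<longlonglongrightarrow> K p r j * 1 / (K p r i * 1)"
    using K_pos'[OF il] by (intro tendsto_divide tendsto_mult tendsto_const alpha_root_lim j il) auto
  then have 2: "(\<lambda>N. (K p r j * alpha_root p r M j N / (K p r i * alpha_root p r M i N)) ^ N) \<longlonglongrightarrow> 0"
    using less K_pos'[OF il] K_pos'[OF j(1)] alpha_root_pos'[OF j(1)] alpha_root_pos'[OF il]
    by (intro power_index_tendsto_0) (auto intro!: divide_nonneg_nonneg mult_nonneg_nonneg less_imp_le)
  show "(\<lambda>N. K p r j ^ N * alpha_seq p r M j N / (K p r i ^ N * alpha_seq p r M i N)) \<longlonglongrightarrow> 0"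
    by (rule Lim_transform_eventually[OF 2])
       (use eventually_gt_at_top[of 0] in eventually_elim,
        simp add: alpha_root[OF j(1)] alpha_root[OF il] power_divide power_mult_distrib)
qed

lemma stage_prob_tendsto_1:
  assumes "i \<le> l" "admissible i"
  shows "(\<lambda>N. stage_prob p (M N) N i) \<longlonglongrightarrow> 1"
  unfolding stage_prob_def
proof (rule Bernstein_window_tendsto_1)
  show "\<forall>\<^sub>F N in sequentially. M N (Suc i) \<le> Suc N"
    using eventually_ge_at_top[of "Suc l"]
  proof eventually_elim
    case (elim N)
    then interpret stages l N "M N" p by (intro stages) auto
    show ?case using T_mono[of "Suc i" "Suc l"] T_end assms(1) by simp
  qed
qed (use assms p_pos p_less_1 M_lim in auto)

lemma stage_weight_eq:
  assumes "l \<le> N" "0 < N" "i \<le> l"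
  shows "stage_weight p (M N) N i
    = K p r i ^ N * alpha_seq p r M i N * stage_prob p (M N) N i / (1 - p i)"
proof -
  interpret stages l N "M N" p using stages assms by simp
  have "stage_scale p (M N) N i = K p r i ^ N * alpha_seq p r M i N"
    using assms(3) p_pos p_less_1 by (intro stage_scale_conv_K T_mono) auto
  then show ?thesis by (simp add: stage_weight_def)
qed

text \<open>
  Only \<open>0 \<le> stage_prob \<le> 1\<close> is needed outside the dominant stages, since \<open>K\<close> is exponentially
  smaller there; no large deviation estimate enters.
\<close>

lemma stage_average_tendsto:
  assumes c: "\<And>N. 0 < c N"
    and u: "\<And>i. i \<in> dominant l p r \<Longrightarrow> (\<lambda>N. K p r i ^ N * alpha_seq p r M i N / c N) \<longlonglongrightarrow> u i"
    and z: "\<And>i. i \<le> l \<Longrightarrow> i \<notin> dominant l p r \<Longrightarrow>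
      (\<lambda>N. K p r i ^ N * alpha_seq p r M i N / c N) \<longlonglongrightarrow> 0"
    and nz: "(\<Sum>i\<in>dominant l p r. u i / (1 - p i)) \<noteq> 0"
  shows "(\<lambda>N. 2 * ((\<Sum>i\<le>l. p i * stage_weight p (M N) N i) / (\<Sum>i\<le>l. stage_weight p (M N) N i)) - 1)
    \<longlonglongrightarrow> (\<Sum>i\<in>dominant l p r. u i / (1 - p i) * (2 * p i - 1)) / (\<Sum>i\<in>dominant l p r. u i / (1 - p i))"
proof -
  define D where "D = dominant l p r"
  define v where "v i = (if i \<in> D then u i / (1 - p i) else 0)" for i
  have V: "(\<lambda>N. stage_weight p (M N) N i / c N) \<longlonglongrightarrow> v i" if i: "i \<le> l" for i
  proof -
    let ?a = "\<lambda>N. K p r i ^ N * alpha_seq p r M i N / c N"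
    have "(\<lambda>N. ?a N * stage_prob p (M N) N i / (1 - p i)) \<longlonglongrightarrow> v i"
    proof (cases "i \<in> D")
      case True
      then have "(\<lambda>N. ?a N * stage_prob p (M N) N i / (1 - p i)) \<longlonglongrightarrow> u i * 1 / (1 - p i)"
        using p_less_1[OF i] dominantD[of i]
        by (intro tendsto_divide tendsto_mult tendsto_const u stage_prob_tendsto_1) (auto simp: D_def)
      then show ?thesis using True by (simp add: v_def)
    next
      case False
      have "(\<lambda>N. ?a N * stage_prob p (M N) N i) \<longlonglongrightarrow> 0"
      proof (rule Lim_null_comparison)
        show "?a \<longlonglongrightarrow> 0" using z[OF i] False by (simp add: D_def)
        show "\<forall>\<^sub>F N in sequentially. norm (?a N * stage_prob p (M N) N i) \<le> ?a N"
          using eventually_ge_at_top[of "Suc l"]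
        proof eventually_elim
          case (elim N)
          then interpret stages l N "M N" p by (intro stages) auto
          have "0 \<le> ?a N" using K_pos'[OF i] alpha_seq_pos[OF i, of N] c[of N] by simp
          then have "0 \<le> ?a N * stage_prob p (M N) N i" "?a N * stage_prob p (M N) N i \<le> ?a N"
            using stage_prob_bounds[OF i] by (blast intro: mult_nonneg_nonneg mult_left_le)+
          then show ?case by (simp only: real_norm_def abs_of_nonneg)
        qed
      qed
      then have "(\<lambda>N. ?a N * stage_prob p (M N) N i / (1 - p i)) \<longlonglongrightarrow> 0 / (1 - p i)"
        using p_less_1[OF i] by (intro tendsto_divide tendsto_const) auto
      then show ?thesis using False by (simp add: v_def)
    qed
    moreover have "\<forall>\<^sub>F N in sequentially.
        ?a N * stage_prob p (M N) N i / (1 - p i) = stage_weight p (M N) N i / c N"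
      using eventually_ge_at_top[of "Suc l"]
      by eventually_elim (simp add: stage_weight_eq i)
    ultimately show ?thesis by (rule Lim_transform_eventually)
  qed
  have sum_v: "(\<Sum>i\<le>l. h i * v i) = (\<Sum>i\<in>D. h i * (u i / (1 - p i)))" for h :: "nat \<Rightarrow> real"
    unfolding v_def using dominantD(1) by (intro sum.mono_neutral_cong_right) (auto simp: D_def)
  have nz': "(\<Sum>i\<le>l. v i) \<noteq> 0" using nz sum_v[of "\<lambda>_. 1"] by (simp add: D_def)
  have "(\<lambda>N. 2 * ((\<Sum>i\<le>l. p i * (stage_weight p (M N) N i / c N)) / (\<Sum>i\<le>l. stage_weight p (M N) N i / c N)) - 1)
      \<longlonglongrightarrow> 2 * ((\<Sum>i\<le>l. p i * v i) / (\<Sum>i\<le>l. v i)) - 1"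
    using nz' V by (intro tendsto_diff tendsto_mult tendsto_divide tendsto_sum tendsto_const) auto
  moreover have "(\<Sum>i\<le>l. p i * (stage_weight p (M N) N i / c N)) / (\<Sum>i\<le>l. stage_weight p (M N) N i / c N)
      = (\<Sum>i\<le>l. p i * stage_weight p (M N) N i) / (\<Sum>i\<le>l. stage_weight p (M N) N i)" for N
    using c[of N] by (simp add: sum_divide_distrib[symmetric])
  moreover have "2 * ((\<Sum>i\<le>l. p i * v i) / (\<Sum>i\<le>l. v i)) - 1
      = (\<Sum>i\<in>D. u i / (1 - p i) * (2 * p i - 1)) / (\<Sum>i\<in>D. u i / (1 - p i))"
  proof -
    have "2 * ((\<Sum>i\<le>l. p i * v i) / (\<Sum>i\<le>l. v i)) - 1 = (2 * (\<Sum>i\<le>l. p i * v i) - (\<Sum>i\<le>l. v i)) / (\<Sum>i\<le>l. v i)"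
      using nz' by (simp add: diff_divide_distrib)
    also have "2 * (\<Sum>i\<le>l. p i * v i) - (\<Sum>i\<le>l. v i) = (\<Sum>i\<le>l. (2 * p i - 1) * v i)"
      by (simp add: sum_distrib_left sum_subtractf left_diff_distrib mult.assoc)
    finally show ?thesis using sum_v[of "\<lambda>i. 2 * p i - 1"] sum_v[of "\<lambda>_. 1"] by (simp add: mult.commute)
  qed
  ultimately show ?thesis by (simp only: D_def)
qed

text \<open>Dividing by the scale of stage \<open>j\<close> itself makes its limit 1 even if
  \<open>alpha_seq\<close> at \<open>j\<close> diverges or oscillates. This serves both a unique
  maximiser and an infinite \<open>\<alpha> j\<close>.\<close>

lemma stage_average_tendsto_single:
  assumes j: "j \<in> dominant l p r"
    and ratio: "\<And>i. i \<in> dominant l p r \<Longrightarrow> i \<noteq> j \<Longrightarrow>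
      (\<lambda>N. alpha_seq p r M i N / alpha_seq p r M j N) \<longlonglongrightarrow> 0"
  shows "(\<lambda>N. 2 * ((\<Sum>i\<le>l. p i * stage_weight p (M N) N i) / (\<Sum>i\<le>l. stage_weight p (M N) N i)) - 1)
    \<longlonglongrightarrow> 2 * p j - 1"
proof -
  define u :: "nat \<Rightarrow> real" where "u i = (if i = j then 1 else 0)" for i
  have jl: "j \<le> l" using dominantD[OF j] by simp
  have sum_u: "(\<Sum>i\<in>dominant l p r. u i / (1 - p i) * h i) = h j / (1 - p j)" for h
  proof -
    have "(\<Sum>i\<in>dominant l p r. u i / (1 - p i) * h i)
        = (\<Sum>i\<in>dominant l p r. if i = j then h j / (1 - p j) else 0)"
      by (intro sum.cong) (auto simp: u_def)
    then show ?thesis using j by simp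
  qed
  have "(\<lambda>N. K p r i ^ N * alpha_seq p r M i N / (K p r j ^ N * alpha_seq p r M j N)) \<longlonglongrightarrow> u i"
    if i: "i \<in> dominant l p r" for i
  proof -
    have "K p r i ^ N * alpha_seq p r M i N / (K p r j ^ N * alpha_seq p r M j N)
        = alpha_seq p r M i N / alpha_seq p r M j N" for N
      using K_dominant_eq[OF i j] K_pos'[OF jl] by simp
    moreover have "(\<lambda>N. alpha_seq p r M i N / alpha_seq p r M j N) \<longlonglongrightarrow> u i"
    proof (cases "i = j")
      case True
      have "alpha_seq p r M j N / alpha_seq p r M j N = 1" for N
        using alpha_seq_pos[OF jl, of N] by simp
      then show ?thesis using True by (simp add: u_def)
    next
      case False
      then show ?thesis using ratio[OF i] by (simp add: u_def)
    qed
    ultimately show ?thesis by simp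
  qed
  then have "(\<lambda>N. 2 * ((\<Sum>i\<le>l. p i * stage_weight p (M N) N i) / (\<Sum>i\<le>l. stage_weight p (M N) N i)) - 1)
    \<longlonglongrightarrow> (\<Sum>i\<in>dominant l p r. u i / (1 - p i) * (2 * p i - 1)) / (\<Sum>i\<in>dominant l p r. u i / (1 - p i))"
    using dominated_scale_tendsto_0(2)[OF j] K_pos'[OF jl] alpha_seq_pos[OF jl] sum_u[of "\<lambda>_. 1"] p_less_1[OF jl]
    by (intro stage_average_tendsto[where c = "\<lambda>N. K p r j ^ N * alpha_seq p r M j N"]) auto
  then show ?thesis using sum_u[of "\<lambda>i. 2 * p i - 1"] sum_u[of "\<lambda>_. 1"] p_less_1[OF jl] by simp
qed

end

section \<open>The limit of the speed\<close>

theorem theorem4: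
  fixes l :: nat
    and p r :: "nat \<Rightarrow> real"
    and M :: "nat \<Rightarrow> nat \<Rightarrow> nat"
    and P :: "nat \<Rightarrow> 'a measure"
    and X :: "nat \<Rightarrow> nat \<Rightarrow> 'a \<Rightarrow> int"
    and x0 :: "nat \<Rightarrow> int"
  assumes "l \<ge> 1"
    and "0 < p 0" and "strict_mono_on {0..l} p" and "p l < 1"
    and "\<And>N. N \<ge> l \<Longrightarrow> 1 \<le> M N 1"
    and "\<And>N. N \<ge> l \<Longrightarrow> strict_mono_on {1..l} (M N)"
    and "\<And>N. N \<ge> l \<Longrightarrow> M N l \<le> N"
    and "\<And>N. N \<ge> l \<Longrightarrow> M N 0 = 0"
    and "\<And>N. N \<ge> l \<Longrightarrow> M N (Suc l) = N + 1"
    and "\<And>i. i \<in> {1..l} \<Longrightarrow> (\<lambda>N. real (M N i) / real N) \<longlonglongrightarrow> r i"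
    and "r 0 = 0" and "r (Suc l) = 1"
    and "\<And>N. N \<ge> l \<Longrightarrow> excited_walk (P N) (X N) (x0 N) N l (M N) p"
  shows
    "(\<forall>i0. dominant l p r = {i0} \<longrightarrow>
        (\<lambda>N. speed (P N) (X N)) \<longlonglongrightarrow> 2 * p i0 - 1) \<and>
     (\<forall>\<alpha> :: nat \<Rightarrow> ennreal.
        card (dominant l p r) \<ge> 2 \<and>
        (\<forall>i \<in> dominant l p r. (\<lambda>N. ennreal (alpha_seq p r M i N)) \<longlonglongrightarrow> \<alpha> i) \<and>
        card {i \<in> dominant l p r. \<alpha> i = \<infinity>} \<le> 1 \<and>
        (\<exists>i \<in> dominant l p r. \<alpha> i \<noteq> 0) \<longrightarrow>
        ((\<forall>i \<in> dominant l p r. \<alpha> i \<noteq> \<infinity>) \<longrightarrow>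
           (\<lambda>N. speed (P N) (X N)) \<longlonglongrightarrow>
             (\<Sum>i\<in>dominant l p r. enn2real (\<alpha> i) / (1 - p i) * (2 * p i - 1)) /
             (\<Sum>i\<in>dominant l p r. enn2real (\<alpha> i) / (1 - p i))) \<and>
        (\<forall>j \<in> dominant l p r. \<alpha> j = \<infinity> \<longrightarrow>
           (\<lambda>N. speed (P N) (X N)) \<longlonglongrightarrow> 2 * p j - 1))"
proof -
  have p_strict: "p i < p j" if "i < j" "j \<le> l" for i j
    using assms(3) that by (auto simp: strict_mono_on_def)
  have M_mono: "M N i < M N (Suc i)" if N: "l \<le> N" and i: "i \<le> l" for N i
  proof -
    consider "i = 0" | "1 \<le> i" "i < l" | "i = l" "1 \<le> i" using i by linarith
    then show ?thesis
    proof cases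
      case 1
      then show ?thesis using assms(5)[OF N] assms(8)[OF N] by simp
    next
      case 2
      then show ?thesis using strict_mono_onD[OF assms(6)[OF N], of i "Suc i"] by simp
    next
      case 3
      then show ?thesis using assms(7)[OF N] assms(9)[OF N] by simp
    qed
  qed
  have stages_M: "stages l N (M N) p" if N: "l \<le> N" for N
  proof
    show "p i \<le> p j" if "i \<le> j" "j \<le> l" for i j
      using p_strict[of i j] that by (cases "i = j") auto
  qed (use assms(1,2,4,8,9) M_mono N in auto)
  have M_lim: "(\<lambda>N. real (M N i) / real N) \<longlonglongrightarrow> r i" if "i \<le> Suc l" for i
  proof -
    consider "i = 0" | "i \<in> {1..l}" | "i = Suc l" using \<open>i \<le> Suc l\<close> by fastforce
    then show ?thesis
    proof cases
      case 1
      have "\<forall>\<^sub>F N in sequentially. 0 = real (M N i) / real N"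
        using eventually_ge_at_top[of l] by eventually_elim (simp add: assms(8) 1)
      then show ?thesis using Lim_transform_eventually[OF tendsto_const] 1 assms(11) by metis
    next
      case 2
      then show ?thesis by (rule assms(10))
    next
      case 3
      have "(\<lambda>N. 1 + 1 / real N) \<longlonglongrightarrow> 1 + 0"
        by (intro tendsto_add tendsto_const lim_const_over_n)
      moreover have "\<forall>\<^sub>F N in sequentially. 1 + 1 / real N = real (M N i) / real N"
        using eventually_ge_at_top[of l] eventually_gt_at_top[of 0]
        by eventually_elim (simp add: assms(9) 3 field_simps)
      ultimately show ?thesis using Lim_transform_eventually 3 assms(12) by fastforce
    qed
  qed
  interpret threshold_family l p r M
    by (rule threshold_family.intro) ((rule assms(2,4,11,12) p_strict stages_M M_lim; assumption)+)
  let ?D = "dominant l p r"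
  let ?s = "\<lambda>N. 2 * ((\<Sum>i\<le>l. p i * stage_weight p (M N) N i) / (\<Sum>i\<le>l. stage_weight p (M N) N i)) - 1"
  have speed: "(\<lambda>N. speed (P N) (X N)) \<longlonglongrightarrow> v" if "?s \<longlonglongrightarrow> v" for v
  proof (rule Lim_transform_eventually[OF that])
    show "\<forall>\<^sub>F N in sequentially. ?s N = speed (P N) (X N)"
      using eventually_ge_at_top[of l]
      by eventually_elim (rule excited_walk.speed_eq_stage_average[OF assms(13) stages_M, symmetric])
  qed
  show ?thesis
  proof (intro conjI allI impI ballI, goal_cases)
    case (1 i0)
    \<comment> \<open>With a single dominant stage the condition on ratios is vacuous.\<close>
    then show ?case by (intro speed stage_average_tendsto_single) auto
  next
    case (2 \<alpha>)
    \<comment> \<open>One nonzero limit makes the denominator positive. The same \<open>k\<close>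
      supplies the common normalisation \<open>K p r k ^ N\<close>.\<close>
    then obtain k where k: "k \<in> ?D" "\<alpha> k \<noteq> 0" by blast
    have lim: "(\<lambda>N. alpha_seq p r M i N) \<longlonglongrightarrow> enn2real (\<alpha> i)" if "i \<in> ?D" for i
    proof (rule tendsto_ennrealD)
      show "(\<lambda>N. ennreal (alpha_seq p r M i N)) \<longlonglongrightarrow> ennreal (enn2real (\<alpha> i))"
        using 2 that by (simp add: less_top[symmetric])
      show "\<forall>\<^sub>F N in sequentially. 0 \<le> alpha_seq p r M i N"
        using alpha_seq_pos[of i] dominantD(1)[OF that] by (intro always_eventually) (auto intro: less_imp_le)
    qed simp
    have "0 < (\<Sum>i\<in>?D. enn2real (\<alpha> i) / (1 - p i))"
    proof (rule sum_pos2[OF _ k(1)])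
      show "0 < enn2real (\<alpha> k) / (1 - p k)"
        using k 2 p_less_1[of k] dominantD(1)[OF k(1)]
        by (auto simp: enn2real_positive_iff less_top[symmetric] zero_less_iff_neq_zero)
      show "0 \<le> enn2real (\<alpha> i) / (1 - p i)" if "i \<in> ?D" for i
        using p_less_1[of i] dominantD(1)[OF that] by simp
    qed simp
    moreover have "(\<lambda>N. K p r i ^ N * alpha_seq p r M i N / K p r k ^ N) \<longlonglongrightarrow> enn2real (\<alpha> i)"
      if "i \<in> ?D" for i
      using lim[OF that] K_dominant_eq[OF that k(1)] K_pos'[OF dominantD(1)[OF k(1)]] by simp
    ultimately show ?case
      using dominated_scale_tendsto_0(1)[OF k(1)] K_pos'[OF dominantD(1)[OF k(1)]]
      by (intro speed stage_average_tendsto[where c = "\<lambda>N. K p r k ^ N"]) auto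
  next
    case (3 \<alpha> j)
    \<comment> \<open>The stage \<open>j\<close> has divergent \<open>alpha_seq\<close>, while every
      other dominant stage has a finite limit: a second infinite one would give a two-element set.
      All ratios against \<open>j\<close> thus vanish.\<close>
    have top: "filterlim (alpha_seq p r M j) at_top sequentially"
      using 3 ennreal_tendsto_top_eq_at_top[of "alpha_seq p r M j" sequentially] by auto
    show ?case
    proof (intro speed stage_average_tendsto_single)
      fix i assume i: "i \<in> ?D" "i \<noteq> j"
      have "\<alpha> i \<noteq> \<infinity>"
      proof
        assume "\<alpha> i = \<infinity>"
        then have "card {i, j} \<le> card {i \<in> ?D. \<alpha> i = \<infinity>}"
          using 3 i by (intro card_mono) auto
        then show False using 3 i by simp
      qed
      then have "(\<lambda>N. ennreal (alpha_seq p r M i N)) \<longlonglongrightarrow> ennreal (enn2real (\<alpha> i))"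
        using 3 i by (simp add: less_top[symmetric])
      moreover have "\<forall>\<^sub>F N in sequentially. 0 \<le> alpha_seq p r M i N"
        using alpha_seq_pos[of i] dominantD(1)[OF i(1)] by (intro always_eventually) (auto intro: less_imp_le)
      ultimately have "alpha_seq p r M i \<longlonglongrightarrow> enn2real (\<alpha> i)"
        by (intro tendsto_ennrealD) auto
      then show "(\<lambda>N. alpha_seq p r M i N / alpha_seq p r M j N) \<longlonglongrightarrow> 0"
        using top by (intro real_tendsto_divide_at_top)
    qed (use 3 in auto)
  qed
qed

end
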